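(* Let $N\geq 1$ be an integer and let $A_0,A_1,\ldots,A_N,B_1,\ldots,B_N\in \mathbb{R}^{3\times 3}$. Then the trigonometric Wahba problem $$\text{(TW)}\qquad \max_{\substack{Q\in SO(3)\\ \omega\in [-\pi,\pi)}} \langle A_0,Q\rangle + \sum_{n=1}^{N}\left[ \langle A_n,\cos(\omega n)Q\rangle + \langle B_n,\sin(\omega n)Q\rangle\right]$$ and the semidefinite optimization problem $$\text{(SDP)}\qquad \begin{aligned}\max_{(X_n)_{n=0}^{N},(Y_n)_{n=1}^{N}}\;&\langle \mathcal{A}^*(A_0),X_0\rangle + \sum_{n=1}^{N}\left[\langle \mathcal{A}^*(A_n),X_n\rangle + \langle \mathcal{A}^*(B_n),Y_n\rangle\right]\\ \text{s.t.}\;\;& \mathrm{Toeplitz}(X_0,X_1,\ldots,X_N) + \mathrm{Hankel}(Y_N,Y_{N-1},\ldots,Y_1,0,-Y_1,\ldots,-Y_{N-1},-Y_N) \succeq 0,\\ & \mathrm{tr}(X_0) = 1,\end{aligned}$$ where the decision variables $X_0,X_1,\ldots,X_N,Y_1,\ldots,Y_N$ range over $\mathcal{S}^4$, have the same optimal value. The set of optimal points $(X_0,X_1,Y_1,\ldots,X_N,Y_N)$ of (SDP) is $$\mathrm{conv}\,\{(qq^T,qq^T\cos(\omega),qq^T\sin(\omega),\ldots,qq^T\cos(N\omega),qq^T\sin(N\omega)):\ q\in\mathbb{H},\ \omega\in[-\pi,\pi),\ (\omega,\mathcal{A}(qq^T))\text{ is an optimal point for (TW)}\}.$$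
   Context: $\mathcal{S}^n$ is the space of real symmetric $n\times n$ matrices; $X\succeq 0$ means $X$ is symmetric positive semidefinite. For real matrices, $\langle X,Y\rangle = \mathrm{tr}(X^TY)$. $SO(3)$ is the set of $3\times 3$ rotation matrices. $\mathbb{H}=\{q\in\mathbb{R}^4:\|q\|=1\}$ is the Euclidean unit sphere (unit quaternions). $\mathrm{conv}(S)$ is the set of all (finite) convex combinations of elements of $S$. The linear map $\mathcal{A}:\mathcal{S}^4\to\mathbb{R}^{3\times 3}$ is $$\mathcal{A}(Z) = \begin{bmatrix} Z_{11} - Z_{22} - Z_{33} + Z_{44} & 2Z_{12} + 2Z_{34} & 2Z_{13} - 2Z_{24}\\2Z_{12} - 2Z_{34} & -Z_{11} + Z_{22} - Z_{33} + Z_{44} & 2Z_{23}+2Z_{14}\\ 2Z_{13} + 2Z_{24} & 2Z_{23} - 2Z_{14} & -Z_{11} - Z_{22} + Z_{33} + Z_{44}\end{bmatrix}$$ (so that $SO(3)=\{\mathcal{A}(qq^T):q\in\mathbb{H}\}$), and its adjoint $\mathcal{A}^*:\mathbb{R}^{3\times 3}\to\mathcal{S}^4$, satisfying $\langle\mathcal{A}(Z),Y\rangle=\langle Z,\mathcal{A}^*(Y)\rangle$ for all $Z\in\mathcal{S}^4$, $Y\in\mathbb{R}^{3\times 3}$, is $$\mathcal{A}^*(Y) = \begin{bmatrix} Y_{11}-Y_{22}-Y_{33} & Y_{12} + Y_{21} & Y_{13}+Y_{31} & Y_{23}-Y_{32}\\ Y_{12}+Y_{21} & -Y_{11}+Y_{22}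 - Y_{33} & Y_{23}+Y_{32}& -Y_{13} + Y_{31}\\ Y_{13}+Y_{31} & Y_{23} + Y_{32} & -Y_{11} - Y_{22} + Y_{33} & Y_{12}-Y_{21}\\ Y_{23} - Y_{32} & -Y_{13}+Y_{31} & Y_{12}-Y_{21} & Y_{11} + Y_{22} + Y_{33}\end{bmatrix}.$$ Block matrices: for $d\times d$ matrices $T_0,\ldots,T_N$ with $T_0$ symmetric, $\mathrm{Toeplitz}(T_0,T_1,\ldots,T_N)$ is the $d(N+1)\times d(N+1)$ symmetric block matrix whose $(j,k)$ block ($0\le j,k\le N$) is $T_{k-j}$ if $k\geq j$ and $T_{j-k}^T$ if $k<j$. For symmetric $d\times d$ matrices $S_1,\ldots,S_{2N+1}$, $\mathrm{Hankel}(S_1,S_2,\ldots,S_{2N+1})$ is the $d(N+1)\times d(N+1)$ block matrix whose $(j,k)$ block ($0\le j,k\le N$) is $S_{j+k+1}$. Here $d=4$. *)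

theory Defs
  imports "HOL-Analysis.Analysis"
begin

definition mat_inner :: "real^'n^'m \<Rightarrow> real^'n^'m \<Rightarrow> real" where
  "mat_inner X Y = trace (transpose X ** Y)"

definition outer :: "real^'n \<Rightarrow> real^'n^'n" where
  "outer q = (\<chi> i j. q $ i * q $ j)"

text \<open>\<open>calA\<close> is defined on all 4 by 4 matrices, but only used on symmetric ones.\<close>

definition calA :: "real^4^4 \<Rightarrow> real^3^3" where
  "calA Z = vector [
     vector [Z$1$1 - Z$2$2 - Z$3$3 + Z$4$4, 2 * Z$1$2 + 2 * Z$3$4, 2 * Z$1$3 - 2 * Z$2$4],
     vector [2 * Z$1$2 - 2 * Z$3$4, - Z$1$1 + Z$2$2 - Z$3$3 + Z$4$4, 2 * Z$2$3 + 2 * Z$1$4],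
     vector [2 * Z$1$3 + 2 * Z$2$4, 2 * Z$2$3 - 2 * Z$1$4, - Z$1$1 - Z$2$2 + Z$3$3 + Z$4$4]]"

definition calA_adj :: "real^3^3 \<Rightarrow> real^4^4" where
  "calA_adj Y = vector [
     vector [Y$1$1 - Y$2$2 - Y$3$3, Y$1$2 + Y$2$1, Y$1$3 + Y$3$1, Y$2$3 - Y$3$2],
     vector [Y$1$2 + Y$2$1, - Y$1$1 + Y$2$2 - Y$3$3, Y$2$3 + Y$3$2, - Y$1$3 + Y$3$1],
     vector [Y$1$3 + Y$3$1, Y$2$3 + Y$3$2, - Y$1$1 - Y$2$2 + Y$3$3, Y$1$2 - Y$2$1],
     vector [Y$2$3 - Y$3$2, - Y$1$3 + Y$3$1, Y$1$2 - Y$2$1, Y$1$1 + Y$2$2 + Y$3$3]]"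

lemma vector_4:
  "(vector [x,y,z,w] :: 'a::zero^4) $ 1 = x"
  "(vector [x,y,z,w] :: 'a::zero^4) $ 2 = y"
  "(vector [x,y,z,w] :: 'a::zero^4) $ 3 = z"
  "(vector [x,y,z,w] :: 'a::zero^4) $ 4 = w"
  unfolding vector_def by simp_all

lemma calA_adjoint:
  assumes "transpose Z = Z"
  shows "mat_inner (calA Z) Y = mat_inner Z (calA_adj Y)"
proof -
  have sym: "Z $ i $ j = Z $ j $ i" for i j
    using arg_cong[OF assms, of "\<lambda>M. M $ j $ i"] by (simp add: transpose_def)
  show ?thesis
    unfolding mat_inner_def trace_def matrix_matrix_mult_def transpose_def calA_def calA_adj_def
    by (simp add: sum_3 sum_4 vector_4 sym[of 2 1] sym[of 3 1] sym[of 4 1] sym[of 3 2]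
        sym[of 4 2] sym[of 4 3] algebra_simps)
qed

text \<open>
  A matrix of \<open>(N+1)\<^sup>2\<close> blocks of size \<open>d\<close> is a function of two index pairs
  \<open>(block number, position within the block)\<close>, considered on the finite index set
  \<open>{0..N} \<times> UNIV\<close> only; \<open>d\<close> is the cardinality of the type \<open>'d\<close>.
\<close>

definition psd_on :: "'i set \<Rightarrow> ('i \<Rightarrow> 'i \<Rightarrow> real) \<Rightarrow> bool" where
  "psd_on I M \<longleftrightarrow> (\<forall>r\<in>I. \<forall>s\<in>I. M r s = M s r) \<and>
     (\<forall>v :: 'i \<Rightarrow> real. 0 \<le> (\<Sum>r\<in>I. \<Sum>s\<in>I. v r * M r s * v s))"

definition block_toeplitz :: "(nat \<Rightarrow> real^'d^'d) \<Rightarrow> nat \<times> 'd \<Rightarrow> nat \<times> 'd \<Rightarrow> real" where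
  "block_toeplitz T = (\<lambda>(j, a) (k, b).
     (if j \<le> k then T (k - j) else transpose (T (j - k))) $ a $ b)"

text \<open>The sequence \<open>S\<close> is numbered from 1.\<close>

definition block_hankel :: "(nat \<Rightarrow> real^'d^'d) \<Rightarrow> nat \<times> 'd \<Rightarrow> nat \<times> 'd \<Rightarrow> real" where
  "block_hankel S = (\<lambda>(j, a) (k, b). S (j + k + 1) $ a $ b)"

text \<open>The sequence \<open>Y\<^sub>N, \<dots>, Y\<^sub>1, 0, -Y\<^sub>1, \<dots>, -Y\<^sub>N\<close>, numbered from 1 to \<open>2N+1\<close>.\<close>

definition hankel_seq :: "nat \<Rightarrow> (nat \<Rightarrow> real^'d^'d) \<Rightarrow> nat \<Rightarrow> real^'d^'d" where
  "hankel_seq N Y i =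
     (if i \<le> N then Y (N + 1 - i) else if i = N + 1 then 0 else - Y (i - (N + 1)))"

text \<open>Points \<open>(\<omega>, Q)\<close> of the trigonometric Wahba problem; \<open>A 0, \<dots>, A N\<close> and
  \<open>B 1, \<dots>, B N\<close> are the data, other values of \<open>A\<close> and \<open>B\<close> are irrelevant.\<close>

definition tw_feasible :: "real \<times> (real^3^3) \<Rightarrow> bool" where
  "tw_feasible = (\<lambda>(\<omega>, Q). rotation_matrix Q \<and> \<omega> \<in> {-pi..<pi})"

definition tw_objective ::
  "nat \<Rightarrow> (nat \<Rightarrow> real^3^3) \<Rightarrow> (nat \<Rightarrow> real^3^3) \<Rightarrow> real \<times> (real^3^3) \<Rightarrow> real" where
  "tw_objective N A B = (\<lambda>(\<omega>, Q). mat_inner (A 0) Q +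
     (\<Sum>n=1..N. mat_inner (A n) (cos (\<omega> * real n) *\<^sub>R Q) +
               mat_inner (B n) (sin (\<omega> * real n) *\<^sub>R Q)))"

text \<open>
  The tuple of decision variables \<open>(X\<^sub>n)\<close> for \<open>0 \<le> n \<le> N\<close> and \<open>(Y\<^sub>n)\<close> for
  \<open>1 \<le> n \<le> N\<close> is a pair of sequences that vanish outside these index ranges, so that
  distinct pairs are distinct tuples.
\<close>

type_synonym sdp_point = "(nat \<Rightarrow> real^4^4) \<times> (nat \<Rightarrow> real^4^4)"

definition sdp_feasible :: "nat \<Rightarrow> sdp_point \<Rightarrow> bool" where
  "sdp_feasible N = (\<lambda>(X, Y).
     (\<forall>n. n \<notin> {0..N} \<longrightarrow> X n = 0) \<and> (\<forall>n. n \<notin> {1..N} \<longrightarrow> Y n = 0) \<and>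
     (\<forall>n\<in>{0..N}. transpose (X n) = X n) \<and> (\<forall>n\<in>{1..N}. transpose (Y n) = Y n) \<and>
     psd_on ({0..N} \<times> UNIV)
       (\<lambda>r s. block_toeplitz X r s + block_hankel (hankel_seq N Y) r s) \<and>
     trace (X 0) = 1)"

definition sdp_objective ::
  "nat \<Rightarrow> (nat \<Rightarrow> real^3^3) \<Rightarrow> (nat \<Rightarrow> real^3^3) \<Rightarrow> sdp_point \<Rightarrow> real" where
  "sdp_objective N A B = (\<lambda>(X, Y). mat_inner (calA_adj (A 0)) (X 0) +
     (\<Sum>n=1..N. mat_inner (calA_adj (A n)) (X n) + mat_inner (calA_adj (B n)) (Y n)))"

text \<open>The maximum is \<open>v\<close>, and it is attained.\<close>

definition is_max_value :: "('p \<Rightarrow> real) \<Rightarrow> ('p \<Rightarrow> bool) \<Rightarrow> real \<Rightarrow> bool" where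
  "is_max_value f P v \<longleftrightarrow> (\<exists>x. P x \<and> f x = v) \<and> (\<forall>x. P x \<longrightarrow> f x \<le> v)"

definition moment_point :: "nat \<Rightarrow> real^4 \<Rightarrow> real \<Rightarrow> sdp_point" where
  "moment_point N q \<omega> =
     (\<lambda>n. if n \<in> {0..N} then cos (real n * \<omega>) *\<^sub>R outer q else 0,
      \<lambda>n. if n \<in> {1..N} then sin (real n * \<omega>) *\<^sub>R outer q else 0)"

text \<open>Finite convex combinations, taken componentwise: the library's \<open>convex hull\<close> needs
  a type of class \<open>real_vector\<close>, which the function type is not.\<close>

definition conv :: "sdp_point set \<Rightarrow> sdp_point set" where
  "conv S = {(\<lambda>n. \<Sum>i<m. u i *\<^sub>R fst (p i) n, \<lambda>n. \<Sum>i<m. u i *\<^sub>R snd (p i) n) | m u p.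
     (\<forall>i<m. 0 \<le> u i \<and> p i \<in> S) \<and> (\<Sum>i<(m::nat). u i) = 1}"

end

theory Submission
  imports Defs
begin

text \<open>
  Both parts of the theorem follow from one fact: the feasible set of the semidefinite problem is
  the convex hull of the moment points \<open>(q q\<^sup>T cos(n \<omega>), q q\<^sup>T sin(n \<omega>))\<close> of unit
  quaternions \<open>q\<close> and angles \<open>\<omega>\<close>. The objective is linear and takes at such a point the value of
  the Wahba objective at \<open>(\<omega>, \<A>(q q\<^sup>T))\<close>, and every rotation is some \<open>\<A>(q q\<^sup>T)\<close>
  (\<open>rotation_quaternion\<close>). A linear function on a convex hull has the same maximum as on the
  generating points, and its maximizers are the convex combinations of the optimal generating
  points.

  Moment points are feasible because their constraint matrix has rank one
  (\<open>moment_point_feasible\<close>). The substance is the converse,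
  \<open>feasible_in_conv_moment_points\<close>, a truncated trigonometric moment problem for matrices.
  A unitary change of basis built from the reversal of the block rows turns the Toeplitz plus Hankel
  matrix into the Hermitian block Toeplitz matrix with blocks \<open>X\<^sub>n - \<i> Y\<^sub>n\<close>,
  here in real form (\<open>psd_complex_blocks\<close>). Such a positive semidefinite Toeplitz matrix
  can be extended to any larger length \<open>L\<close>, since the only unknown entries of a one-step
  extension form a corner that can be completed (\<open>psd_completion_entry\<close>,
  \<open>psd_toeplitz_extend\<close>). For each angle the Fejer sum of the extended sequence is positive
  semidefinite, since its quadratic form is a sum of values of the form of the Toeplitz matrix.
  Evaluated at \<open>2 L\<close> equidistant angles, these sums form a discrete matrix measure whose
  moments are \<open>(1 - n / L) X\<^sub>n\<close> and \<open>(1 - n / L) Y\<^sub>n\<close>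
  (\<open>fejer_means_are_moments\<close>). All its matrices are real and symmetric, so they are sums of
  terms \<open>q q\<^sup>T\<close> with real \<open>q\<close>. Caratheodory's theorem bounds the number
  of terms independently of \<open>L\<close>, and compactness lets \<open>L\<close> tend to infinity
  (\<open>feasible_is_moment_sum\<close>). The limit is needed because the means only approximate the
  given point.
\<close>

section \<open>Completing positive semidefinite kernels\<close>

lemma psd_onD:
  assumes "psd_on I M"
  shows "0 \<le> (\<Sum>r\<in>I. \<Sum>s\<in>I. v r * M r s * v s)"
  using assms by (simp add: psd_on_def)

lemma psd_on_sym: "psd_on I M \<Longrightarrow> r \<in> I \<Longrightarrow> s \<in> I \<Longrightarrow> M r s = M s r"
  by (simp add: psd_on_def)

lemma psd_on_cong:
  assumes "\<And>r s. r \<in> I \<Longrightarrow> s \<in> I \<Longrightarrow> M r s = M' r s"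
  shows "psd_on I M \<longleftrightarrow> psd_on I M'"
  unfolding psd_on_def by (simp add: assms cong: sum.cong)

lemma psd_on_subset:
  assumes "psd_on I M" "J \<subseteq> I" "finite I"
  shows "psd_on J M"
  unfolding psd_on_def
proof (intro conjI allI)
  show "\<forall>r\<in>J. \<forall>s\<in>J. M r s = M s r"
    using assms(1,2) by (auto simp: psd_on_def)
next
  fix v :: "'a \<Rightarrow> real"
  let ?w = "\<lambda>i. if i \<in> J then v i else 0"
  have "(\<Sum>r\<in>J. \<Sum>s\<in>J. v r * M r s * v s) = (\<Sum>r\<in>I. \<Sum>s\<in>I. ?w r * M r s * ?w s)"
    by (intro sum.mono_neutral_cong_left sum.neutral ballI) (use assms(2,3) in auto)
  then show "0 \<le> (\<Sum>r\<in>J. \<Sum>s\<in>J. v r * M r s * v s)"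
    using psd_onD[OF assms(1), of ?w] by simp
qed

lemma quadratic_form_insert:
  fixes M :: "'i \<Rightarrow> 'i \<Rightarrow> real"
  assumes "finite I" "r \<notin> I" and sym: "\<And>i. i \<in> I \<Longrightarrow> M i r = M r i"
  shows "(\<Sum>i\<in>insert r I. \<Sum>j\<in>insert r I. v i * M i j * v j) =
    (\<Sum>i\<in>I. \<Sum>j\<in>I. v i * M i j * v j) + (v r)\<^sup>2 * M r r + 2 * v r * (\<Sum>i\<in>I. v i * M r i)"
proof -
  have "(\<Sum>i\<in>I. v i * M i r * v r) = v r * (\<Sum>i\<in>I. v i * M r i)"
    by (simp add: sum_distrib_left sym mult_ac cong: sum.cong)
  moreover have "(\<Sum>i\<in>I. v r * M r i * v i) = v r * (\<Sum>i\<in>I. v i * M r i)"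
    by (simp add: sum_distrib_left mult_ac)
  ultimately show ?thesis
    using assms(1,2) by (simp add: sum.distrib power2_eq_square algebra_simps)
qed

lemma psd_on_insert_form_nonneg:
  assumes "finite I" "r \<notin> I" "psd_on (insert r I) M"
  shows "0 \<le> (\<Sum>i\<in>I. \<Sum>j\<in>I. v i * M i j * v j) + a\<^sup>2 * M r r + 2 * a * (\<Sum>i\<in>I. v i * M r i)"
proof -
  let ?w = "v(r := a)"
  have eq: "(\<Sum>i\<in>I. \<Sum>j\<in>I. ?w i * M i j * ?w j) = (\<Sum>i\<in>I. \<Sum>j\<in>I. v i * M i j * v j)"
    "(\<Sum>i\<in>I. ?w i * M r i) = (\<Sum>i\<in>I. v i * M r i)"
    using assms(2) by (auto intro!: sum.cong)
  have "0 \<le> (\<Sum>i\<in>insert r I. \<Sum>j\<in>insert r I. ?w i * M i j * ?w j)"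
    by (rule psd_onD[OF assms(3)])
  also have "\<dots> = (\<Sum>i\<in>I. \<Sum>j\<in>I. ?w i * M i j * ?w j) + (?w r)\<^sup>2 * M r r +
      2 * ?w r * (\<Sum>i\<in>I. ?w i * M r i)"
    using assms(1,2) psd_on_sym[OF assms(3)] by (intro quadratic_form_insert) auto
  finally show ?thesis by (simp add: eq del: fun_upd_apply) (simp)
qed

text \<open>  If only the entry at \<open>(r, s)\<close> of a symmetric kernel is unknown, and both principal subkernels
  that avoid it are positive semidefinite, then the entry can be filled in. Scale the coefficient
  of \<open>r\<close> in the quadratic form to \<open>1\<close> and call the coefficient of \<open>s\<close> now \<open>b\<close>. Nonnegativity for
  \<open>b > 0\<close> bounds the unknown entry from below, nonnegativity for \<open>b < 0\<close> from above, and the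
  two families of bounds have to be compatible. They are: the unknown cancels from a suitable
  positive combination of two such conditions, and what remains is a value of the form on the
  index set without \<open>s\<close> plus one on the index set without \<open>r\<close>.\<close>

lemma psd_completion_entry:
  fixes M :: "'i \<Rightarrow> 'i \<Rightarrow> real"
  assumes fin: "finite I" and rs: "r \<notin> I" "s \<notin> I" "r \<noteq> s"
    and R: "psd_on (insert r I) M" and S: "psd_on (insert s I) M"
  obtains x where "psd_on (insert r (insert s I))
    (\<lambda>i j. if i = r \<and> j = s \<or> i = s \<and> j = r then x else M i j)"
proof -
  define Q where "Q v = (\<Sum>i\<in>I. \<Sum>j\<in>I. v i * M i j * v j)" for v
  define lr where "lr v = (\<Sum>i\<in>I. v i * M r i)" for v
  define ls where "ls v = (\<Sum>i\<in>I. v i * M s i)" for v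
  define F where "F v b = Q v + M r r + b\<^sup>2 * M s s + 2 * lr v + 2 * b * ls v" for v b
  have Qr: "0 \<le> Q v + a\<^sup>2 * M r r + 2 * a * lr v" for v a
    unfolding Q_def lr_def by (rule psd_on_insert_form_nonneg[OF fin rs(1) R])
  have Qs: "0 \<le> Q v + a\<^sup>2 * M s s + 2 * a * ls v" for v a
    unfolding Q_def ls_def by (rule psd_on_insert_form_nonneg[OF fin rs(2) S])
  have Q_scale: "Q (\<lambda>i. c * v i) = c\<^sup>2 * Q v" for c v
    by (simp add: Q_def sum_distrib_left power2_eq_square mult_ac)
  have l_scale: "lr (\<lambda>i. c * v i) = c * lr v" "ls (\<lambda>i. c * v i) = c * ls v" for c v
    by (simp_all add: lr_def ls_def sum_distrib_left mult_ac)
  have Q_split: "(g + b) * (g * Q v + b * Q v') =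
      Q (\<lambda>i. g * v i + b * v' i) + g * b * Q (\<lambda>i. v i - v' i)" for g b v v'
    unfolding Q_def sum_distrib_left sum.distrib[symmetric]
    by (intro sum.cong refl) (simp add: algebra_simps)
  have l_split: "lr (\<lambda>i. g * v i + b * v' i) = g * lr v + b * lr v'"
    "ls (\<lambda>i. v i - v' i) = ls v - ls v'" for g b v v'
    by (simp_all add: lr_def ls_def sum_distrib_left sum.distrib sum_subtractf algebra_simps)
  have bounds: "- F v b / (2 * b) \<le> F v' (- g) / (2 * g)" if "b > 0" "g > 0" for v v' b g
  proof -
    \<comment> \<open>The convexity identity for \<open>Q\<close> separates the two known forms: the
      weighted mean of \<open>v\<close> and \<open>v'\<close> goes with \<open>r\<close>, their
      difference with \<open>s\<close>.\<close>
    have "(g + b) * (g * F v b + b * F v' (- g)) =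
        (Q (\<lambda>i. g * v i + b * v' i) + (g + b)\<^sup>2 * M r r + 2 * (g + b) * lr (\<lambda>i. g * v i + b * v' i))
        + g * b * (Q (\<lambda>i. v i - v' i) + (g + b)\<^sup>2 * M s s + 2 * (g + b) * ls (\<lambda>i. v i - v' i))"
    proof -
      have "(g + b) * (g * F v b + b * F v' (- g)) = (g + b) * (g * Q v + b * Q v') +
         (g + b)\<^sup>2 * M r r + g * b * (g + b)\<^sup>2 * M s s +
         2 * (g + b) * (g * lr v + b * lr v') + 2 * (g + b) * g * b * (ls v - ls v')"
        unfolding F_def by (simp add: algebra_simps power2_eq_square)
      then show ?thesis unfolding Q_split l_split by (simp add: algebra_simps)
    qed
    also have "\<dots> \<ge> 0" using that by (intro add_nonneg_nonneg[OF Qr mult_nonneg_nonneg[OF _ Qs]]) simp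
    finally have "0 \<le> g * F v b + b * F v' (- g)" using that
      by (simp add: zero_le_mult_iff)
    then show ?thesis using that by (simp add: field_simps)
  qed
  \<comment> \<open>The least value that meets the lower bounds; it meets the upper bounds by
    \<open>bounds\<close>.\<close>
  define x where "x = (SUP (v, b) \<in> UNIV \<times> {0<..}. - F v b / (2 * b))"
  have bdd: "bdd_above ((\<lambda>(v, b). - F v b / (2 * b)) ` (UNIV \<times> {0<..}))"
    by (rule bdd_aboveI[where M = "F (\<lambda>_. 0) (- 1) / (2 * 1)"]) (use bounds[of _ 1] in auto)
  have lower: "- F v b / (2 * b) \<le> x" if "b > 0" for v b
    unfolding x_def using that by (intro cSUP_upper2[OF bdd, where x = "(v, b)"]) auto
  have upper: "x \<le> F v (- g) / (2 * g)" if "g > 0" for v g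
    unfolding x_def using that bounds by (intro cSUP_least) (auto intro!: exI[of _ 1])
  have F_nonneg: "0 \<le> F v b + 2 * b * x" for v b
  proof -
    consider "b > 0" | "b = 0" | "b < 0" by linarith
    then show ?thesis
    proof cases
      case 1 then show ?thesis using lower[of b v] by (simp add: field_simps)
    next
      case 2 then show ?thesis using Qr[of v 1] by (simp add: F_def)
    next
      case 3 then show ?thesis using upper[of "- b" v] by (simp add: field_simps)
    qed
  qed
  have form: "0 \<le> Q v + a\<^sup>2 * M r r + b\<^sup>2 * M s s + 2 * a * lr v + 2 * b * ls v + 2 * a * b * x" for v a b
  proof (cases "a = 0")
    case True
    then show ?thesis using Qs[of v b] by simp
  next
    case False
    have "0 \<le> a\<^sup>2 * (F (\<lambda>i. (1 / a) * v i) (b / a) + 2 * (b / a) * x)"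
      by (rule mult_nonneg_nonneg[OF zero_le_power2 F_nonneg])
    also have "\<dots> = Q v + a\<^sup>2 * M r r + b\<^sup>2 * M s s + 2 * a * lr v + 2 * b * ls v + 2 * a * b * x"
      unfolding F_def Q_scale l_scale using False by (simp add: field_simps power2_eq_square)
    finally show ?thesis .
  qed
  let ?M = "\<lambda>i j. if i = r \<and> j = s \<or> i = s \<and> j = r then x else M i j"
  have sym: "?M i j = ?M j i" if "i \<in> insert r (insert s I)" "j \<in> insert r (insert s I)" for i j
    using that psd_on_sym[OF R] psd_on_sym[OF S] by auto
  have "0 \<le> (\<Sum>i\<in>insert r (insert s I). \<Sum>j\<in>insert r (insert s I). v i * ?M i j * v j)" for v
  proof -
    have eqs: "(\<Sum>i\<in>I. \<Sum>j\<in>I. v i * ?M i j * v j) = Q v" "(\<Sum>i\<in>I. v i * ?M r i) = lr v"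
        "(\<Sum>i\<in>I. v i * ?M s i) = ls v"
      unfolding Q_def lr_def ls_def using rs by (auto intro!: sum.cong)
    have "(\<Sum>i\<in>insert r (insert s I). \<Sum>j\<in>insert r (insert s I). v i * ?M i j * v j) =
       (\<Sum>i\<in>insert s I. \<Sum>j\<in>insert s I. v i * ?M i j * v j) + (v r)\<^sup>2 * ?M r r +
       2 * v r * (\<Sum>i\<in>insert s I. v i * ?M r i)"
      using fin rs by (intro quadratic_form_insert sym) auto
    also have "(\<Sum>i\<in>insert s I. \<Sum>j\<in>insert s I. v i * ?M i j * v j) =
       (\<Sum>i\<in>I. \<Sum>j\<in>I. v i * ?M i j * v j) + (v s)\<^sup>2 * ?M s s + 2 * v s * (\<Sum>i\<in>I. v i * ?M s i)"
      using fin rs by (intro quadratic_form_insert sym) auto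
    also have "(\<Sum>i\<in>insert s I. v i * ?M r i) = v s * ?M r s + (\<Sum>i\<in>I. v i * ?M r i)"
      using fin rs by (subst sum.insert) auto
    finally show ?thesis using form[of v "v r" "v s"] rs(3)
      unfolding eqs by (simp add: algebra_simps)
  qed
  then show ?thesis using that sym unfolding psd_on_def by blast
qed

text \<open>The unknown entries are filled in one after the other, first along a row.\<close>

lemma psd_completion_row:
  fixes M :: "'i \<Rightarrow> 'i \<Rightarrow> real"
  assumes "finite S" "finite I" "r \<notin> I" "r \<notin> S" "I \<inter> S = {}"
    "psd_on (insert r I) M" "psd_on (I \<union> S) M"
  shows "\<exists>M'. psd_on (insert r (I \<union> S)) M' \<and>
    (\<forall>i j. \<not> (i = r \<and> j \<in> S) \<and> \<not> (j = r \<and> i \<in> S) \<longrightarrow> M' i j = M i j)"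
  using assms
proof (induction S rule: finite_induct)
  case empty
  then show ?case by auto
next
  case (insert s S)
  have "psd_on (I \<union> S) M"
    using insert.prems(1,6) insert.hyps(1) by (auto intro: psd_on_subset)
  then obtain M' where M': "psd_on (insert r (I \<union> S)) M'"
    "\<And>i j. \<not> (i = r \<and> j \<in> S) \<Longrightarrow> \<not> (j = r \<and> i \<in> S) \<Longrightarrow> M' i j = M i j"
    using insert.IH insert.prems by auto
  have "psd_on (insert s (I \<union> S)) M"
    using insert.prems(6) by (simp add: insert_commute)
  also have "?this \<longleftrightarrow> psd_on (insert s (I \<union> S)) M'"
    by (rule psd_on_cong) (use insert.prems in \<open>auto intro!: M'(2)[symmetric]\<close>)
  finally have *: "psd_on (insert s (I \<union> S)) M'" .
  obtain x where x: "psd_on (insert r (insert s (I \<union> S)))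
      (\<lambda>i j. if i = r \<and> j = s \<or> i = s \<and> j = r then x else M' i j)"
    by (rule psd_completion_entry[OF _ _ _ _ M'(1) *]) (use insert in auto)
  show ?case
    by (rule exI, rule conjI, use x in simp) (use M'(2) in auto)
qed

lemma psd_completion_block:
  fixes M :: "'i \<Rightarrow> 'i \<Rightarrow> real"
  assumes "finite R" "finite S" "finite I" "R \<inter> I = {}" "R \<inter> S = {}" "I \<inter> S = {}"
    "psd_on (R \<union> I) M" "psd_on (I \<union> S) M"
  shows "\<exists>M'. psd_on (R \<union> I \<union> S) M' \<and>
    (\<forall>i j. \<not> (i \<in> R \<and> j \<in> S) \<and> \<not> (j \<in> R \<and> i \<in> S) \<longrightarrow> M' i j = M i j)"
  using assms
proof (induction R rule: finite_induct)
  case empty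
  then show ?case by auto
next
  case (insert r R)
  have "psd_on (R \<union> I) M"
    using insert.prems(2,6) insert.hyps(1) by (auto intro: psd_on_subset)
  then obtain M' where M': "psd_on (R \<union> I \<union> S) M'"
    "\<And>i j. \<not> (i \<in> R \<and> j \<in> S) \<Longrightarrow> \<not> (j \<in> R \<and> i \<in> S) \<Longrightarrow> M' i j = M i j"
    using insert.IH insert.prems by auto
  have "psd_on (insert r (R \<union> I)) M"
    using insert.prems(6) by simp
  also have "?this \<longleftrightarrow> psd_on (insert r (R \<union> I)) M'"
    by (rule psd_on_cong) (use insert.prems in \<open>auto intro!: M'(2)[symmetric]\<close>)
  finally have *: "psd_on (insert r (R \<union> I)) M'" .
  have disj: "r \<notin> R \<union> I" "r \<notin> S" "(R \<union> I) \<inter> S = {}"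
    using insert.prems insert.hyps by auto
  obtain M'' where M'': "psd_on (insert r (R \<union> I \<union> S)) M''"
      "\<And>i j. \<not> (i = r \<and> j \<in> S) \<Longrightarrow> \<not> (j = r \<and> i \<in> S) \<Longrightarrow> M'' i j = M' i j"
    using psd_completion_row[OF insert.prems(1) _ _ _ _ * M'(1)] disj insert.prems(2)
      insert.hyps(1) by auto
  show ?case
    by (rule exI[of _ M''], rule conjI, use M''(1) in simp) (use M'(2) M''(2) in auto)
qed

section \<open>Extending block Toeplitz sequences\<close>

definition toeplitz_kernel :: "(int \<Rightarrow> 'd \<Rightarrow> 'd \<Rightarrow> real) \<Rightarrow> nat \<times> 'd \<Rightarrow> nat \<times> 'd \<Rightarrow> real" where
  "toeplitz_kernel T = (\<lambda>(j, a) (k, b). T (int k - int j) a b)"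

text \<open>  Passing from \<open>N\<close> to \<open>N + 1\<close> leaves only the corner block at \<open>(0, N + 1)\<close> unknown. The rows
  \<open>0, \<dots>, N\<close> and the rows \<open>1, \<dots>, N + 1\<close> both carry the given Toeplitz kernel, so the completion
  of the corner applies. Each coefficient of the new term of the sequence occurs only once in
  that corner, so the completed kernel is again Toeplitz.\<close>

lemma psd_toeplitz_extend_one:
  fixes T :: "int \<Rightarrow> 'd::finite \<Rightarrow> 'd \<Rightarrow> real"
  assumes "psd_on ({..N} \<times> UNIV) (toeplitz_kernel T)"
  shows "\<exists>T'. psd_on ({..Suc N} \<times> UNIV) (toeplitz_kernel T') \<and>
    (\<forall>n. \<bar>n\<bar> \<le> int N \<longrightarrow> T' n = T n)"
proof -
  let ?R = "{0} \<times> (UNIV :: 'd set)" and ?S = "{Suc N} \<times> (UNIV :: 'd set)"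
    and ?I = "{1..N} \<times> (UNIV :: 'd set)"
  have un: "?R \<union> ?I = {..N} \<times> UNIV" "?I \<union> ?S = {1..Suc N} \<times> UNIV"
    "?R \<union> ?I \<union> ?S = {..Suc N} \<times> UNIV"
    by auto
  have shift: "psd_on (?I \<union> ?S) (toeplitz_kernel T)"
  proof -
    let ?f = "\<lambda>(j, a). (Suc j, a :: 'd)"
    have "psd_on (?f ` ({..N} \<times> UNIV)) (toeplitz_kernel T)"
      unfolding psd_on_def
    proof (intro conjI allI)
      show "\<forall>r\<in>?f ` ({..N} \<times> UNIV). \<forall>s\<in>?f ` ({..N} \<times> UNIV).
          toeplitz_kernel T r s = toeplitz_kernel T s r"
        using psd_on_sym[OF assms] by (force simp: toeplitz_kernel_def)
    next
      fix v :: "nat \<times> 'd \<Rightarrow> real"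
      have inj: "inj_on ?f A" for A by (auto simp: inj_on_def)
      have "(\<Sum>r\<in>?f ` ({..N} \<times> UNIV). \<Sum>s\<in>?f ` ({..N} \<times> UNIV). v r * toeplitz_kernel T r s * v s)
         = (\<Sum>r\<in>{..N} \<times> UNIV. \<Sum>s\<in>{..N} \<times> UNIV. v (?f r) * toeplitz_kernel T r s * v (?f s))"
        unfolding sum.reindex[OF inj] by (intro sum.cong refl) (simp add: toeplitz_kernel_def split_beta)
      also have "\<dots> \<ge> 0"
        by (rule psd_onD[OF assms])
      finally show "0 \<le> (\<Sum>r\<in>?f ` ({..N} \<times> UNIV). \<Sum>s\<in>?f ` ({..N} \<times> UNIV).
          v r * toeplitz_kernel T r s * v s)" .
    qed
    also have "?f ` ({..N} \<times> UNIV) = ?I \<union> ?S"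
    proof -
      have "{1..Suc N} = Suc ` {..N}"
        by (simp add: image_Suc_atMost)
      then show ?thesis unfolding un by force
    qed
    finally show ?thesis .
  qed
  have first: "psd_on (?R \<union> ?I) (toeplitz_kernel T)"
    using assms by (simp only: un)
  obtain M where M: "psd_on ({..Suc N} \<times> UNIV) M"
    "\<And>i j. \<not> (i \<in> ?R \<and> j \<in> ?S) \<Longrightarrow> \<not> (j \<in> ?R \<and> i \<in> ?S) \<Longrightarrow> M i j = toeplitz_kernel T i j"
    using psd_completion_block[OF _ _ _ _ _ _ first shift, unfolded un(3)]
    by (auto simp: disjoint_iff)
  define T' where "T' n = (if n = int (Suc N) then \<lambda>a b. M (0, a) (Suc N, b)
     else if n = - int (Suc N) then \<lambda>a b. M (Suc N, a) (0, b) else T n)" for n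
  have "psd_on ({..Suc N} \<times> UNIV) M \<longleftrightarrow> psd_on ({..Suc N} \<times> UNIV) (toeplitz_kernel T')"
  proof (rule psd_on_cong, clarify)
    fix j k :: nat and a b :: 'd
    assume "j \<le> Suc N" "k \<le> Suc N"
    then consider "j = 0" "k = Suc N" | "j = Suc N" "k = 0" |
      "\<bar>int k - int j\<bar> \<le> int N" "\<not> (j = 0 \<and> k = Suc N)" "\<not> (k = 0 \<and> j = Suc N)"
      by linarith
    then show "M (j, a) (k, b) = toeplitz_kernel T' (j, a) (k, b)"
      by cases (auto simp: toeplitz_kernel_def T'_def M(2))
  qed
  then show ?thesis using M(1) by (intro exI[of _ T']) (auto simp: T'_def)
qed

lemma psd_toeplitz_extend:
  fixes T :: "int \<Rightarrow> 'd::finite \<Rightarrow> 'd \<Rightarrow> real"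
  assumes "psd_on ({..N} \<times> UNIV) (toeplitz_kernel T)"
  shows "\<exists>T'. psd_on ({..N + m} \<times> UNIV) (toeplitz_kernel T') \<and>
    (\<forall>n. \<bar>n\<bar> \<le> int N \<longrightarrow> T' n = T n)"
proof (induction m)
  case 0
  then show ?case using assms by auto
next
  case (Suc m)
  then obtain T' where T': "psd_on ({..N + m} \<times> UNIV) (toeplitz_kernel T')"
    "\<And>n. \<bar>n\<bar> \<le> int N \<Longrightarrow> T' n = T n" by auto
  from psd_toeplitz_extend_one[OF this(1)] obtain T'' where
    "psd_on ({..N + Suc m} \<times> UNIV) (toeplitz_kernel T'')"
    "\<And>n. \<bar>n\<bar> \<le> int (N + m) \<Longrightarrow> T'' n = T' n" by auto
  with T' show ?case by (intro exI[of _ T'']) auto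
qed

section \<open>Sums of rank-one kernels\<close>

text \<open>  Cholesky factorization: subtracting the rank-one kernel of row \<open>r\<close> leaves the Schur complement,
  which vanishes on row and column \<open>r\<close>. If the diagonal entry at \<open>r\<close> is \<open>0\<close>, the whole row is,
  and the convention \<open>x / 0 = 0\<close> lets the same formulas cover this case.\<close>

lemma psd_on_factor:
  assumes "finite I" "psd_on I M"
  shows "\<exists>w. \<forall>r\<in>I. \<forall>s\<in>I. M r s = (\<Sum>k\<in>I. w k r * w k s)"
  using assms
proof (induction I arbitrary: M rule: finite_induct)
  case empty
  then show ?case by simp
next
  case (insert r I)
  note form = psd_on_insert_form_nonneg[OF insert.hyps(1,2) insert.prems]
  have rr: "0 \<le> M r r"
    using form[of "\<lambda>_. 0" 1] by simp
  have zero: "M r s = 0" if "M r r = 0" "s \<in> I" for s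
  proof -
    define e where "e i = (if i = s then 1 else 0 :: real)" for i
    have "(\<Sum>i\<in>I. \<Sum>j\<in>I. e i * M i j * e j) = M s s" "(\<Sum>i\<in>I. e i * M r i) = M r s"
    proof -
      have "e i * M i j * e j = (if j = s then if i = s then M s s else 0 else 0)"
        "e i * M r i = (if i = s then M r s else 0)" for i j
        by (simp_all add: e_def)
      then show "(\<Sum>i\<in>I. \<Sum>j\<in>I. e i * M i j * e j) = M s s" "(\<Sum>i\<in>I. e i * M r i) = M r s"
        using that insert.hyps(1) by simp_all
    qed
    then have *: "0 \<le> M s s + 2 * a * M r s" for a
      using form[of e a] that(1) by simp
    \<comment> \<open>The form is affine in \<open>a\<close>; at the chosen \<open>a\<close> it
      would be \<open>- 1\<close>.\<close>
    show ?thesis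
    proof (rule ccontr)
      assume "M r s \<noteq> 0"
      then show False using *[of "- (M s s + 1) / (2 * M r s)"] by (simp add: field_simps)
    qed
  qed
  define M' where "M' i j = M i j - M r i * M r j / M r r" for i j
  have "psd_on I M'"
    unfolding psd_on_def
  proof (intro conjI allI)
    show "\<forall>i\<in>I. \<forall>j\<in>I. M' i j = M' j i"
      using psd_on_sym[OF insert.prems] by (simp add: M'_def)
  next
    fix v
    let ?Q = "\<Sum>i\<in>I. \<Sum>j\<in>I. v i * M i j * v j" and ?l = "\<Sum>i\<in>I. v i * M r i"
    have "(\<Sum>i\<in>I. \<Sum>j\<in>I. v i * M' i j * v j) = ?Q - (\<Sum>i\<in>I. \<Sum>j\<in>I. (v i * M r i) * (v j * M r j)) / M r r"
      unfolding M'_def sum_divide_distrib sum_subtractf[symmetric]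
      by (intro sum.cong refl) (simp add: algebra_simps)
    also have "\<dots> = ?Q - ?l\<^sup>2 / M r r"
      by (simp add: sum_product power2_eq_square)
    \<comment> \<open>The Schur complement is the minimum of the form over the coefficient of
      \<open>r\<close>.\<close>
    also have "\<dots> = ?Q + (- ?l / M r r)\<^sup>2 * M r r + 2 * (- ?l / M r r) * ?l"
      by (cases "M r r = 0") (simp_all add: field_simps power2_eq_square)
    also have "\<dots> \<ge> 0" by (rule form)
    finally show "0 \<le> (\<Sum>i\<in>I. \<Sum>j\<in>I. v i * M' i j * v j)" .
  qed
  from insert.IH[OF this] obtain w where
    w: "\<And>i j. i \<in> I \<Longrightarrow> j \<in> I \<Longrightarrow> M' i j = (\<Sum>k\<in>I. w k i * w k j)" by blast
  define w' where "w' k = (if k = r then \<lambda>i. M r i / sqrt (M r r) else (w k)(r := 0))" for k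
  show ?case
  proof (intro exI[of _ w'] ballI)
    fix i j assume ij: "i \<in> insert r I" "j \<in> insert r I"
    have "(\<Sum>k\<in>insert r I. w' k i * w' k j) = w' r i * w' r j + (\<Sum>k\<in>I. w' k i * w' k j)"
      using insert.hyps by simp
    also have "w' r i * w' r j = M r i * M r j / M r r"
      using rr by (simp add: w'_def)
    also have "(\<Sum>k\<in>I. w' k i * w' k j) = (if i = r \<or> j = r then 0 else M' i j)"
    proof -
      have "(\<Sum>k\<in>I. w' k i * w' k j) = (\<Sum>k\<in>I. if i = r \<or> j = r then 0 else w k i * w k j)"
        using insert.hyps by (intro sum.cong refl) (auto simp: w'_def)
      then show ?thesis using w ij by auto
    qed
    finally show "M i j = (\<Sum>k\<in>insert r I. w' k i * w' k j)"
      using zero ij psd_on_sym[OF insert.prems] by (auto simp: M'_def)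
  qed
qed

section \<open>From Toeplitz plus Hankel to Hermitian Toeplitz\<close>

text \<open>  Let \<open>J\<close> be the reversal of indices given by the involution \<open>f\<close>. The kernel \<open>t\<close> commutes with
  \<open>J\<close> and \<open>h\<close> anticommutes with it, so the unitary matrix \<open>(I + \<i> J) / \<surd>2\<close> turns the real
  kernel \<open>t + h\<close> into a Hermitian kernel with real part \<open>t\<close> and imaginary part \<open>\<plusminus> h J\<close>.
  The inequality is positivity of that Hermitian kernel at the complex vector with real and
  imaginary parts \<open>x\<close> and \<open>y\<close>, up to the sign of \<open>y\<close>. In real terms: add the form of \<open>t + h\<close> at
  \<open>x + J y\<close> to the form of its reversal \<open>t - h\<close> at \<open>x - J y\<close>.\<close>

lemma psd_on_unflip:
  fixes t h :: "'i \<Rightarrow> 'i \<Rightarrow> real"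
  assumes psd: "psd_on I (\<lambda>r s. t r s + h r s)"
    and f: "\<And>r. r \<in> I \<Longrightarrow> f r \<in> I" "\<And>r. r \<in> I \<Longrightarrow> f (f r) = r"
    and t: "\<And>r s. r \<in> I \<Longrightarrow> s \<in> I \<Longrightarrow> t (f r) (f s) = t r s"
    and h: "\<And>r s. r \<in> I \<Longrightarrow> s \<in> I \<Longrightarrow> h (f r) (f s) = - h r s"
  shows "0 \<le> (\<Sum>r\<in>I. \<Sum>s\<in>I. x r * t r s * x s + y r * t r s * y s +
     x r * h r (f s) * y s + y r * h (f r) s * x s)"
proof -
  have bij: "bij_betw f I I"
    by (rule bij_betw_byWitness[where f' = f]) (use f in auto)
  have re: "(\<Sum>r\<in>I. g (f r)) = (\<Sum>r\<in>I. g r)" for g :: "'i \<Rightarrow> real"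
    by (rule sum.reindex_bij_betw[OF bij])
  have re2: "(\<Sum>r\<in>I. \<Sum>s\<in>I. g (f r) (f s)) = (\<Sum>r\<in>I. \<Sum>s\<in>I. g r s)" for g :: "'i \<Rightarrow> 'i \<Rightarrow> real"
    using re[of "\<lambda>r. \<Sum>s\<in>I. g r s"] re by simp
  define u where "u r = x r + y (f r)" for r
  define w where "w r = x r - y (f r)" for r
  have "0 \<le> (\<Sum>r\<in>I. \<Sum>s\<in>I. u r * (t r s + h r s) * u s)"
    by (rule psd_onD[OF psd])
  moreover have "0 \<le> (\<Sum>r\<in>I. \<Sum>s\<in>I. w r * (t r s - h r s) * w s)"
  proof -
    have "0 \<le> (\<Sum>r\<in>I. \<Sum>s\<in>I. w (f r) * (t r s + h r s) * w (f s))"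
      by (rule psd_onD[OF psd])
    also have "\<dots> = (\<Sum>r\<in>I. \<Sum>s\<in>I. w (f r) * (t (f r) (f s) - h (f r) (f s)) * w (f s))"
      by (simp add: t h cong: sum.cong)
    also have "\<dots> = (\<Sum>r\<in>I. \<Sum>s\<in>I. w r * (t r s - h r s) * w s)"
      by (rule re2)
    finally show ?thesis .
  qed
  ultimately have "0 \<le> (\<Sum>r\<in>I. \<Sum>s\<in>I. u r * (t r s + h r s) * u s + w r * (t r s - h r s) * w s)"
    by (simp add: sum.distrib)
  also have "\<dots> = (\<Sum>r\<in>I. \<Sum>s\<in>I. 2 * (x r * t r s * x s + y (f r) * t r s * y (f s) +
      x r * h r s * y (f s) + y (f r) * h r s * x s))"
    by (intro sum.cong refl) (simp add: u_def w_def algebra_simps)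
  also have "\<dots> = 2 * ((\<Sum>r\<in>I. \<Sum>s\<in>I. x r * t r s * x s) +
      (\<Sum>r\<in>I. \<Sum>s\<in>I. y (f r) * t r s * y (f s)) +
      (\<Sum>r\<in>I. \<Sum>s\<in>I. x r * h r s * y (f s)) + (\<Sum>r\<in>I. \<Sum>s\<in>I. y (f r) * h r s * x s))"
    by (simp add: sum.distrib sum_distrib_left)
  also have "(\<Sum>r\<in>I. \<Sum>s\<in>I. y (f r) * t r s * y (f s)) = (\<Sum>r\<in>I. \<Sum>s\<in>I. y r * t r s * y s)"
    using re2[of "\<lambda>r s. y r * t r s * y s"] by (simp add: t cong: sum.cong)
  also have "(\<Sum>r\<in>I. \<Sum>s\<in>I. x r * h r s * y (f s)) = (\<Sum>r\<in>I. \<Sum>s\<in>I. x r * h r (f s) * y s)"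
  proof (rule sum.cong[OF refl])
    fix r
    show "(\<Sum>s\<in>I. x r * h r s * y (f s)) = (\<Sum>s\<in>I. x r * h r (f s) * y s)"
      using re[of "\<lambda>s. x r * h r (f s) * y s"] by (simp add: f cong: sum.cong)
  qed
  also have "(\<Sum>r\<in>I. \<Sum>s\<in>I. y (f r) * h r s * x s) = (\<Sum>r\<in>I. \<Sum>s\<in>I. y r * h (f r) s * x s)"
    using re[of "\<lambda>r. \<Sum>s\<in>I. y r * h (f r) s * x s"] by (simp add: f cong: sum.cong)
  finally show ?thesis by (simp add: sum.distrib)
qed

text \<open>  The real \<open>2 \<times> 2\<close> block form of the Hermitian Toeplitz sequence
  \<open>X\<^bsub>\<bar>n\<bar>\<^esub> - \<i> sgn(n) Y\<^bsub>\<bar>n\<bar>\<^esub>\<close>, which is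
  \<open>exp(- \<i> n \<omega>) q q\<^sup>T\<close> at a moment point. The boolean index selects the real or the
  imaginary part.\<close>

definition complex_blocks ::
  "(nat \<Rightarrow> real^'d^'d) \<Rightarrow> (nat \<Rightarrow> real^'d^'d) \<Rightarrow> int \<Rightarrow> bool \<times> 'd \<Rightarrow> bool \<times> 'd \<Rightarrow> real" where
  "complex_blocks X Y n = (\<lambda>(\<alpha>, a) (\<beta>, b).
     if \<alpha> = \<beta> then X (nat \<bar>n\<bar>) $ a $ b
     else (if \<beta> then 1 else - 1) * of_int (sgn n) * Y (nat \<bar>n\<bar>) $ a $ b)"

lemma sum_bool_blocks:
  fixes F :: "nat \<times> (bool \<times> 'd::finite) \<Rightarrow> real"
  shows "(\<Sum>r\<in>{..N} \<times> UNIV. F r) =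
    (\<Sum>r\<in>{..N} \<times> UNIV. F (fst r, (False, snd r)) + F (fst r, (True, snd r)))"
proof -
  have "(\<Sum>r\<in>{..N} \<times> UNIV. F r) = (\<Sum>j\<le>N. \<Sum>\<alpha>\<in>UNIV. \<Sum>a\<in>UNIV. F (j, (\<alpha>, a)))"
    by (simp add: sum.cartesian_product split_beta')
  also have "\<dots> = (\<Sum>j\<le>N. \<Sum>a\<in>UNIV. F (j, (False, a)) + F (j, (True, a)))"
    by (simp add: UNIV_bool sum.distrib)
  finally show ?thesis by (simp add: sum.cartesian_product split_beta')
qed

text \<open>  The Hankel part has the blocks \<open>Y\<^bsub>N-j-k\<^esub>\<close>, with \<open>Y\<close> extended to an odd sequence,
  so the reversal \<open>k \<mapsto> N - k\<close> of the block columns alone makes it a Toeplitz matrix. Reversing rows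
  and columns together negates it, and fixes the Toeplitz part because the \<open>X\<^sub>n\<close> are symmetric.\<close>

lemma psd_complex_blocks:
  fixes X Y :: "nat \<Rightarrow> real^'d::finite^'d"
  assumes psd: "psd_on ({0..N} \<times> UNIV)
       (\<lambda>r s. block_toeplitz X r s + block_hankel (hankel_seq N Y) r s)"
    and X: "\<And>n. n \<le> N \<Longrightarrow> transpose (X n) = X n"
    and Y: "\<And>n. n \<in> {1..N} \<Longrightarrow> transpose (Y n) = Y n"
  shows "psd_on ({..N} \<times> UNIV) (toeplitz_kernel (complex_blocks X Y))"
proof -
  define t where "t = (\<lambda>(j, a) (k, b). X (nat \<bar>int k - int j\<bar>) $ a $ b)"
  define h where "h = (\<lambda>(j, a) (k, b). of_int (sgn (int N - int j - int k)) *
     Y (nat \<bar>int N - int j - int k\<bar>) $ a $ b)"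
  define f :: "nat \<times> 'd \<Rightarrow> nat \<times> 'd" where "f = (\<lambda>(j, a). (N - j, a))"
  let ?I = "{..N} \<times> (UNIV :: 'd set)"
  have X_sym: "X n $ a $ b = X n $ b $ a" if "n \<le> N" for n a b
    using arg_cong[OF X[OF that], of "\<lambda>M. M $ b $ a"] by (simp add: transpose_def)
  have Y_sym: "Y n $ a $ b = Y n $ b $ a" if "n \<in> {1..N}" for n a b
    using arg_cong[OF Y[OF that], of "\<lambda>M. M $ b $ a"] by (simp add: transpose_def)
  have psd': "psd_on ?I (\<lambda>r s. t r s + h r s)"
  proof -
    have "block_toeplitz X r s + block_hankel (hankel_seq N Y) r s = t r s + h r s"
      if "r \<in> ?I" "s \<in> ?I" for r s
    proof (cases r, cases s)
      fix j k :: nat and a b :: 'd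
      assume rs: "r = (j, a)" "s = (k, b)"
      have "block_toeplitz X r s = t r s"
      proof (cases "j \<le> k")
        case True
        then show ?thesis by (simp add: rs block_toeplitz_def t_def nat_diff_distrib)
      next
        case False
        then have "nat \<bar>int k - int j\<bar> = j - k" by simp
        with False show ?thesis using that rs X[of "j - k"]
          by (simp add: block_toeplitz_def t_def)
      qed
      moreover have "block_hankel (hankel_seq N Y) r s = h r s"
      proof -
        consider "j + k < N" | "j + k = N" | "j + k > N" by linarith
        then show ?thesis
        proof cases
          case 1
          then have "nat \<bar>int N - int j - int k\<bar> = N - (j + k)" "sgn (int N - int j - int k) = 1"
            by simp_all
          with 1 show ?thesis by (simp add: rs block_hankel_def hankel_seq_def h_def)
        next
          case 2
          then show ?thesis by (auto simp: rs block_hankel_def hankel_seq_def h_def)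
        next
          case 3
          then have "nat \<bar>int N - int j - int k\<bar> = j + k - N" "sgn (int N - int j - int k) = - 1"
            by simp_all
          with 3 show ?thesis by (simp add: rs block_hankel_def hankel_seq_def h_def)
        qed
      qed
      ultimately show ?thesis by simp
    qed
    then have "psd_on ?I (\<lambda>r s. block_toeplitz X r s + block_hankel (hankel_seq N Y) r s) \<longleftrightarrow>
        psd_on ?I (\<lambda>r s. t r s + h r s)"
      by (rule psd_on_cong)
    then show ?thesis using psd by (simp only: atLeast0AtMost)
  qed
  have f: "f r \<in> ?I" "f (f r) = r" if "r \<in> ?I" for r
    using that by (auto simp: f_def)
  have t: "t (f r) (f s) = t r s" if "r \<in> ?I" "s \<in> ?I" for r s
    using that by (auto simp: f_def t_def abs_minus_commute of_nat_diff)
  have h: "h (f r) (f s) = - h r s" if "r \<in> ?I" "s \<in> ?I" for r s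
  proof -
    obtain j a k b where rs: "r = (j, a)" "s = (k, b)" by (cases r, cases s) auto
    have "int N - int (N - j) - int (N - k) = - (int N - int j - int k)"
      using that rs by (simp add: of_nat_diff)
    then show ?thesis unfolding rs f_def h_def
      by (simp only: split abs_minus_cancel idom_abs_sgn_class.sgn_minus of_int_minus mult_minus_left)
  qed
  have pos: "0 \<le> (\<Sum>r\<in>?I. \<Sum>s\<in>?I. x r * t r s * x s + y r * t r s * y s +
     x r * h r (f s) * y s + y r * h (f r) s * x s)" for x y
    by (rule psd_on_unflip[where I = ?I and t = t and h = h and f = f, OF psd' f t h])
  show ?thesis
    unfolding psd_on_def
  proof (intro conjI allI)
    show "\<forall>r\<in>{..N} \<times> UNIV. \<forall>s\<in>{..N} \<times> UNIV.
       toeplitz_kernel (complex_blocks X Y) r s = toeplitz_kernel (complex_blocks X Y) s r"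
    proof (intro ballI)
      fix r s :: "nat \<times> bool \<times> 'd"
      assume "r \<in> {..N} \<times> UNIV" "s \<in> {..N} \<times> UNIV"
      moreover obtain j \<alpha> a k \<beta> b where rs: "r = (j, \<alpha>, a)" "s = (k, \<beta>, b)"
        using prod_cases3 by metis
      ultimately have n: "nat \<bar>int k - int j\<bar> \<le> N" by auto
      define m where "m = int k - int j"
      then have m: "int k - int j = m" "int j - int k = - m" by simp_all
      define c where "c = real_of_int (sgn m)"
      have x: "X (nat \<bar>m\<bar>) $ b $ a = X (nat \<bar>m\<bar>) $ a $ b"
        using n unfolding m by (rule X_sym)
      have y: "c * Y (nat \<bar>m\<bar>) $ b $ a = c * Y (nat \<bar>m\<bar>) $ a $ b"
      proof (cases "m = 0")
        case True
        then show ?thesis by (simp add: c_def)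
      next
        case False
        then have "nat \<bar>m\<bar> \<in> {1..N}" using n unfolding m by simp
        from Y_sym[OF this, of b a] show ?thesis by (rule arg_cong)
      qed
      have c: "real_of_int (sgn (- m)) = - c"
        by (simp only: c_def idom_abs_sgn_class.sgn_minus of_int_minus)
      show "toeplitz_kernel (complex_blocks X Y) r s = toeplitz_kernel (complex_blocks X Y) s r"
        unfolding rs toeplitz_kernel_def complex_blocks_def split m abs_minus_cancel c
          c_def[symmetric]
        by (cases \<alpha>; cases \<beta>) (simp_all add: x y)
    qed
  next
    fix v :: "nat \<times> bool \<times> 'd \<Rightarrow> real"
    define x where "x r = v (fst r, (False, snd r))" for r
    define y where "y r = v (fst r, (True, snd r))" for r
    let ?K = "toeplitz_kernel (complex_blocks X Y)"
    have "(\<Sum>r\<in>{..N} \<times> UNIV. \<Sum>s\<in>{..N} \<times> UNIV. v r * ?K r s * v s) =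
      (\<Sum>r\<in>?I. \<Sum>s\<in>?I. x r * t r s * x s + y r * t r s * y s +
     x r * h r (f s) * y s + y r * h (f r) s * x s)"
      unfolding sum_bool_blocks sum.distrib[symmetric]
    proof (intro sum.cong refl)
      fix r s assume "r \<in> ?I" "s \<in> ?I"
      moreover obtain j a k b where rs: "r = (j, a)" "s = (k, b)" by (cases r, cases s) auto
      ultimately have e: "int N - int j - int (N - k) = int k - int j"
        "int N - int (N - j) - int k = - (int k - int j)" by (simp_all add: of_nat_diff)
      have "h r (f s) = of_int (sgn (int k - int j)) * Y (nat \<bar>int k - int j\<bar>) $ a $ b"
        "h (f r) s = - of_int (sgn (int k - int j)) * Y (nat \<bar>int k - int j\<bar>) $ a $ b"
        unfolding rs f_def h_def by (simp_all only: split e abs_minus_cancel idom_abs_sgn_class.sgn_minus of_int_minus)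
      then show "v (fst r, False, snd r) * ?K (fst r, False, snd r) (fst s, False, snd s) * v (fst s, False, snd s) +
            v (fst r, False, snd r) * ?K (fst r, False, snd r) (fst s, True, snd s) * v (fst s, True, snd s) +
           (v (fst r, True, snd r) * ?K (fst r, True, snd r) (fst s, False, snd s) * v (fst s, False, snd s) +
            v (fst r, True, snd r) * ?K (fst r, True, snd r) (fst s, True, snd s) * v (fst s, True, snd s)) =
           x r * t r s * x s + y r * t r s * y s + x r * h r (f s) * y s + y r * h (f r) s * x s"
        by (simp add: rs x_def y_def toeplitz_kernel_def complex_blocks_def t_def)
    qed
    then show "0 \<le> (\<Sum>r\<in>{..N} \<times> UNIV. \<Sum>s\<in>{..N} \<times> UNIV. v r * ?K r s * v s)"
      using pos by simp
  qed
qed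

section \<open>Fejer means at equidistant nodes\<close>

text \<open>  The \<open>2 L\<close> equidistant points of \<open>[-\<pi>, \<pi>)\<close>. This many are needed because a product of two
  trigonometric monomials of degree below \<open>L\<close> has degree below \<open>2 L\<close>; its mean over the nodes
  then agrees with its mean over the circle, and sums can replace integrals.\<close>

definition node :: "nat \<Rightarrow> nat \<Rightarrow> real" where
  "node L i = - pi + pi * real i / real L"

lemma node_range: "i < 2 * L \<Longrightarrow> node L i \<in> {-pi..<pi}"
  by (simp add: node_def field_simps)

lemma sum_cis_node:
  fixes n :: int
  assumes "\<bar>n\<bar> < 2 * int L"
  shows "(\<Sum>i<2 * L. cis (of_int n * node L i)) = (if n = 0 then of_nat (2 * L) else 0)"
proof (cases "n = 0")
  case False
  have L: "L > 0" using assms by linarith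
  define z where "z = cis (of_int n * pi / real L)"
  have "cis (of_int n * node L i) = cis (- of_int n * pi) * z ^ i" for i
  proof -
    have "of_int n * node L i = - of_int n * pi + real i * (of_int n * pi / real L)"
      by (simp add: node_def algebra_simps)
    then show ?thesis by (simp only: z_def Complex.DeMoivre cis_mult)
  qed
  then have "(\<Sum>i<2 * L. cis (of_int n * node L i)) = cis (- of_int n * pi) * (\<Sum>i<2 * L. z ^ i)"
    by (simp add: sum_distrib_left)
  moreover have "z \<noteq> 1"
  proof
    assume "z = 1"
    then have "cos (of_int n * pi / real L) = 1"
      by (simp add: z_def complex_eq_iff)
    then obtain k :: int where "of_int n * pi / real L = of_int k * 2 * pi"
      by (auto simp: cos_one_2pi_int)
    then have "real_of_int n = real_of_int (2 * k * int L)"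
      using L by (simp add: field_simps)
    then have n: "n = k * (2 * int L)" by (simp only: of_int_eq_iff)
    with False have "1 \<le> \<bar>k\<bar>" by auto
    then have "2 * int L \<le> \<bar>k\<bar> * \<bar>2 * int L\<bar>" using mult_right_mono[of 1 "\<bar>k\<bar>" "2 * int L"] by simp
    then show False using assms unfolding n abs_mult by linarith
  qed
  moreover have "z ^ (2 * L) = 1"
  proof -
    have "z ^ (2 * L) = cis (2 * pi * of_int n)"
      unfolding z_def Complex.DeMoivre using L by (simp add: field_simps)
    then show ?thesis using cis_multiple_2pi[of "of_int n"] by simp
  qed
  ultimately show ?thesis using False by (simp add: geometric_sum)
qed simp

lemma sum_cos_node:
  fixes n :: int
  assumes "\<bar>n\<bar> < 2 * int L"
  shows "(\<Sum>i<2 * L. cos (of_int n * node L i)) = (if n = 0 then 2 * real L else 0)"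
  using arg_cong[OF sum_cis_node[OF assms], of Re] by simp

lemma sum_sin_node:
  fixes n :: int
  assumes "\<bar>n\<bar> < 2 * int L"
  shows "(\<Sum>i<2 * L. sin (of_int n * node L i)) = 0"
  using arg_cong[OF sum_cis_node[OF assms], of Im] by simp

lemma node_orthogonality:
  fixes n m :: int
  assumes "\<bar>n\<bar> < int L" "\<bar>m\<bar> < int L"
  shows "(\<Sum>i<2 * L. cos (of_int m * node L i) * cos (of_int n * node L i)) =
      real L * ((if n = m then 1 else 0) + (if n = - m then 1 else 0))"
    and "(\<Sum>i<2 * L. sin (of_int m * node L i) * sin (of_int n * node L i)) =
      real L * ((if n = m then 1 else 0) - (if n = - m then 1 else 0))"
    and "(\<Sum>i<2 * L. cos (of_int m * node L i) * sin (of_int n * node L i)) = 0"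
proof -
  have b: "\<bar>m - n\<bar> < 2 * int L" "\<bar>m + n\<bar> < 2 * int L" using assms by linarith+
  note C = sum_cos_node[OF b(1)] sum_cos_node[OF b(2)] sum_sin_node[OF b(1)] sum_sin_node[OF b(2)]
  have "cos (of_int m * node L i) * cos (of_int n * node L i) =
      (cos (of_int (m - n) * node L i) + cos (of_int (m + n) * node L i)) / 2"
    "sin (of_int m * node L i) * sin (of_int n * node L i) =
      (cos (of_int (m - n) * node L i) - cos (of_int (m + n) * node L i)) / 2"
    "cos (of_int m * node L i) * sin (of_int n * node L i) =
      (sin (of_int (m + n) * node L i) - sin (of_int (m - n) * node L i)) / 2" for i
    by (simp_all add: left_diff_distrib distrib_right cos_add cos_diff sin_add sin_diff)
  then show "(\<Sum>i<2 * L. cos (of_int m * node L i) * cos (of_int n * node L i)) =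
      real L * ((if n = m then 1 else 0) + (if n = - m then 1 else 0))"
    "(\<Sum>i<2 * L. sin (of_int m * node L i) * sin (of_int n * node L i)) =
      real L * ((if n = m then 1 else 0) - (if n = - m then 1 else 0))"
    "(\<Sum>i<2 * L. cos (of_int m * node L i) * sin (of_int n * node L i)) = 0"
    by (simp_all only: sum_divide_distrib[symmetric] sum.distrib sum_subtractf C) auto
qed

text \<open>  There are \<open>L - n\<close> pairs at difference \<open>n\<close>, which is the source of the Fejer weights \<open>1 - n / L\<close>.\<close>

lemma sum_diagonal:
  fixes f :: "int \<Rightarrow> real"
  assumes "n \<le> L"
  shows "(\<Sum>j<L. \<Sum>k<L. f (int k - int j) * (if int k - int j = int n then 1 else 0)) =
      real (L - n) * f (int n)"
    and "(\<Sum>j<L. \<Sum>k<L. f (int k - int j) * (if int k - int j = - int n then 1 else 0)) =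
      real (L - n) * f (- int n)"
proof -
  have count: "(\<Sum>j<L. \<Sum>k<L. if int k - int j = int n then 1 else 0) = real (L - n)"
  proof -
    have "(\<Sum>k<L. if int k - int j = int n then 1 else 0) = (if j < L - n then 1 else (0::real))" for j
    proof -
      have "(\<Sum>k<L. if int k - int j = int n then 1 else 0) =
          (\<Sum>k<L. if k = j + n then 1 else (0::real))"
        by (intro sum.cong refl) auto
      then show ?thesis by auto
    qed
    then have "(\<Sum>j<L. \<Sum>k<L. if int k - int j = int n then 1 else (0::real)) =
        (\<Sum>j<L. if j < L - n then 1 else 0)" by simp
    also have "\<dots> = real (card ({..<L} \<inter> {j. j < L - n}))"
      by (simp add: sum.If_cases)
    also have "{..<L} \<inter> {j. j < L - n} = {..<L - n}" by auto
    finally show ?thesis by simp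
  qed
  have "(\<Sum>j<L. \<Sum>k<L. f (int k - int j) * (if int k - int j = int n then 1 else 0)) =
     (\<Sum>j<L. \<Sum>k<L. f (int n) * (if int k - int j = int n then 1 else 0))"
    by (intro sum.cong refl) auto
  then show "(\<Sum>j<L. \<Sum>k<L. f (int k - int j) * (if int k - int j = int n then 1 else 0)) =
      real (L - n) * f (int n)"
    using count by (simp add: sum_distrib_left[symmetric])
  have "(\<Sum>j<L. \<Sum>k<L. f (int k - int j) * (if int k - int j = - int n then 1 else 0)) =
     (\<Sum>j<L. \<Sum>k<L. f (- int n) * (if int j - int k = int n then 1 else 0))"
  proof (intro sum.cong refl)
    fix j k
    have "int k - int j = - int n \<longleftrightarrow> int j - int k = int n" by linarith
    then show "f (int k - int j) * (if int k - int j = - int n then 1 else 0) =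
        f (- int n) * (if int j - int k = int n then 1 else 0)"
      by (cases "int k - int j = - int n")
        (simp_all only: if_True if_False simp_thms mult_zero_right)
  qed
  also have "\<dots> = f (- int n) * (\<Sum>k<L. \<Sum>j<L. if int j - int k = int n then 1 else 0)"
    by (subst sum.swap) (simp add: sum_distrib_left)
  finally show "(\<Sum>j<L. \<Sum>k<L. f (int k - int j) * (if int k - int j = - int n then 1 else 0)) =
      real (L - n) * f (- int n)"
    using count by simp
qed

text \<open>  For a sequence of the form \<open>complex_blocks X Y\<close> these two are \<open>2 X\<^bsub>\<bar>n\<bar>\<^esub>\<close> and
  \<open>2 sgn(n) Y\<^bsub>\<bar>n\<bar>\<^esub>\<close>. An extension of such a sequence does not in general keep this
  form, but only these combinations of its blocks enter below.\<close>

definition even_part :: "(int \<Rightarrow> bool \<times> 'd \<Rightarrow> bool \<times> 'd \<Rightarrow> real) \<Rightarrow> int \<Rightarrow> 'd \<Rightarrow> 'd \<Rightarrow> real" where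
  "even_part T n a b = T n (False, a) (False, b) + T n (True, a) (True, b)"

definition odd_part :: "(int \<Rightarrow> bool \<times> 'd \<Rightarrow> bool \<times> 'd \<Rightarrow> real) \<Rightarrow> int \<Rightarrow> 'd \<Rightarrow> 'd \<Rightarrow> real" where
  "odd_part T n a b = T n (False, a) (True, b) - T n (True, a) (False, b)"

definition fejer_kernel ::
  "(int \<Rightarrow> bool \<times> 'd \<Rightarrow> bool \<times> 'd \<Rightarrow> real) \<Rightarrow> nat \<Rightarrow> real \<Rightarrow> 'd \<Rightarrow> 'd \<Rightarrow> real" where
  "fejer_kernel T L \<omega> a b = (\<Sum>j<L. \<Sum>k<L.
     even_part T (int k - int j) a b * cos (of_int (int k - int j) * \<omega>) +
     odd_part T (int k - int j) a b * sin (of_int (int k - int j) * \<omega>))"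

text \<open>  The form of the Fejer kernel at \<open>q\<close> is the sum of the forms of the Toeplitz kernel at the two
  vectors with blocks \<open>(cos(j \<omega>) q, sin(j \<omega>) q)\<close> and \<open>(- sin(j \<omega>) q, cos(j \<omega>) q)\<close>. One of them
  alone would leave terms in \<open>(j + k) \<omega>\<close>; these cancel in the sum, by the addition theorems.\<close>

lemma psd_fejer_kernel:
  fixes T :: "int \<Rightarrow> bool \<times> 'd::finite \<Rightarrow> bool \<times> 'd \<Rightarrow> real"
  assumes "psd_on ({..M} \<times> UNIV) (toeplitz_kernel T)"
  shows "psd_on UNIV (fejer_kernel T (Suc M) \<omega>)"
  unfolding psd_on_def
proof (intro conjI allI ballI)
  fix a b :: 'd
  have sym: "T (int k - int j) r s = T (int j - int k) s r" if "j \<le> M" "k \<le> M" for j k r s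
    using psd_on_sym[OF assms, of "(j, r)" "(k, s)"] that by (simp add: toeplitz_kernel_def)
  have "fejer_kernel T (Suc M) \<omega> a b = (\<Sum>j<Suc M. \<Sum>k<Suc M.
     even_part T (int j - int k) b a * cos (of_int (int j - int k) * \<omega>) +
     odd_part T (int j - int k) b a * sin (of_int (int j - int k) * \<omega>))"
    unfolding fejer_kernel_def
  proof (intro sum.cong refl)
    fix j k assume "j \<in> {..<Suc M}" "k \<in> {..<Suc M}"
    then have jk: "j \<le> M" "k \<le> M" by auto
    have "real_of_int (int k - int j) * \<omega> = - (of_int (int j - int k) * \<omega>)"
      by (simp add: algebra_simps)
    then show "even_part T (int k - int j) a b * cos (of_int (int k - int j) * \<omega>) +
        odd_part T (int k - int j) a b * sin (of_int (int k - int j) * \<omega>) =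
        even_part T (int j - int k) b a * cos (of_int (int j - int k) * \<omega>) +
        odd_part T (int j - int k) b a * sin (of_int (int j - int k) * \<omega>)"
      unfolding even_part_def odd_part_def sym[OF jk]
      by (simp only: cos_minus sin_minus) (simp add: algebra_simps)
  qed
  also have "\<dots> = fejer_kernel T (Suc M) \<omega> b a"
    unfolding fejer_kernel_def by (rule sum.swap)
  finally show "fejer_kernel T (Suc M) \<omega> a b = fejer_kernel T (Suc M) \<omega> b a" .
next
  fix q :: "'d \<Rightarrow> real"
  define c where "c j = cos (real j * \<omega>)" for j
  define s where "s j = sin (real j * \<omega>)" for j
  define v where "v = (\<lambda>(j, \<alpha>, a). (if \<alpha> then s j else c j) * q a)"
  define w where "w = (\<lambda>(j, \<alpha>, a). (if \<alpha> then c j else - s j) * q a)"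
  let ?I = "{..M} \<times> (UNIV :: (bool \<times> 'd) set)" and ?J = "{..M} \<times> (UNIV :: 'd set)"
  let ?K = "toeplitz_kernel T"
  have J: "(\<Sum>r\<in>?J. g r) = (\<Sum>j\<le>M. \<Sum>a\<in>UNIV. g (j, a))" for g :: "nat \<times> 'd \<Rightarrow> real"
    by (simp add: sum.cartesian_product)
  have "0 \<le> (\<Sum>r\<in>?I. \<Sum>t\<in>?I. v r * ?K r t * v t) + (\<Sum>r\<in>?I. \<Sum>t\<in>?I. w r * ?K r t * w t)"
    by (intro add_nonneg_nonneg psd_onD[OF assms])
  also have "\<dots> = (\<Sum>r\<in>?J. \<Sum>t\<in>?J. q (snd r) * (
      even_part T (int (fst t) - int (fst r)) (snd r) (snd t) * cos (of_int (int (fst t) - int (fst r)) * \<omega>) +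
      odd_part T (int (fst t) - int (fst r)) (snd r) (snd t) * sin (of_int (int (fst t) - int (fst r)) * \<omega>)) * q (snd t))"
    unfolding sum_bool_blocks sum.distrib[symmetric]
  proof (intro sum.cong refl)
    fix r t :: "nat \<times> 'd"
    obtain j a k b where rs: "r = (j, a)" "t = (k, b)" by (cases r, cases t) auto
    have trig: "cos (of_int (int k - int j) * \<omega>) = c k * c j + s k * s j"
      "sin (of_int (int k - int j) * \<omega>) = s k * c j - c k * s j"
      by (simp_all add: c_def s_def left_diff_distrib cos_diff sin_diff)
    show "v (fst r, False, snd r) * ?K (fst r, False, snd r) (fst t, False, snd t) * v (fst t, False, snd t) +
            v (fst r, False, snd r) * ?K (fst r, False, snd r) (fst t, True, snd t) * v (fst t, True, snd t) +
           (v (fst r, True, snd r) * ?K (fst r, True, snd r) (fst t, False, snd t) * v (fst t, False, snd t) +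
            v (fst r, True, snd r) * ?K (fst r, True, snd r) (fst t, True, snd t) * v (fst t, True, snd t)) +
          (w (fst r, False, snd r) * ?K (fst r, False, snd r) (fst t, False, snd t) * w (fst t, False, snd t) +
            w (fst r, False, snd r) * ?K (fst r, False, snd r) (fst t, True, snd t) * w (fst t, True, snd t) +
           (w (fst r, True, snd r) * ?K (fst r, True, snd r) (fst t, False, snd t) * w (fst t, False, snd t) +
            w (fst r, True, snd r) * ?K (fst r, True, snd r) (fst t, True, snd t) * w (fst t, True, snd t))) =
         q (snd r) * (
      even_part T (int (fst t) - int (fst r)) (snd r) (snd t) * cos (of_int (int (fst t) - int (fst r)) * \<omega>) +
      odd_part T (int (fst t) - int (fst r)) (snd r) (snd t) * sin (of_int (int (fst t) - int (fst r)) * \<omega>)) * q (snd t)"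
      unfolding rs fst_conv snd_conv trig
      by (simp add: v_def w_def toeplitz_kernel_def even_part_def odd_part_def algebra_simps)
  qed
  also have "\<dots> = (\<Sum>j\<le>M. \<Sum>a\<in>UNIV. \<Sum>k\<le>M. \<Sum>b\<in>UNIV. q a * (
      even_part T (int k - int j) a b * cos (of_int (int k - int j) * \<omega>) +
      odd_part T (int k - int j) a b * sin (of_int (int k - int j) * \<omega>)) * q b)"
    by (simp only: J fst_conv snd_conv)
  also have "\<dots> = (\<Sum>a\<in>UNIV. \<Sum>b\<in>UNIV. \<Sum>j\<le>M. \<Sum>k\<le>M. q a * (
      even_part T (int k - int j) a b * cos (of_int (int k - int j) * \<omega>) +
      odd_part T (int k - int j) a b * sin (of_int (int k - int j) * \<omega>)) * q b)"
    by (simp only: sum.swap[of _ "UNIV :: 'd set" "{..M}"])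
  also have "\<dots> = (\<Sum>a\<in>UNIV. \<Sum>b\<in>UNIV. q a * fejer_kernel T (Suc M) \<omega> a b * q b)"
    by (simp add: fejer_kernel_def sum_distrib_left sum_distrib_right lessThan_Suc_atMost)
  finally show "0 \<le> (\<Sum>a\<in>UNIV. \<Sum>b\<in>UNIV. q a * fejer_kernel T (Suc M) \<omega> a b * q b)" .
qed

lemma fejer_kernel_moments:
  assumes "n < L"
  shows "(\<Sum>i<2 * L. cos (real n * node L i) * fejer_kernel T L (node L i) a b) =
      real L * real (L - n) * (even_part T (int n) a b + even_part T (- int n) a b)"
    and "(\<Sum>i<2 * L. sin (real n * node L i) * fejer_kernel T L (node L i) a b) =
      real L * real (L - n) * (odd_part T (int n) a b - odd_part T (- int n) a b)"
proof -
  have pull: "(\<Sum>i<2 * L. g i * fejer_kernel T L (node L i) a b) = (\<Sum>j<L. \<Sum>k<L.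
      even_part T (int k - int j) a b * (\<Sum>i<2 * L. g i * cos (of_int (int k - int j) * node L i)) +
      odd_part T (int k - int j) a b * (\<Sum>i<2 * L. g i * sin (of_int (int k - int j) * node L i)))"
    for g
  proof -
    have "(\<Sum>i<2 * L. g i * fejer_kernel T L (node L i) a b) = (\<Sum>i<2 * L. \<Sum>j<L. \<Sum>k<L.
      even_part T (int k - int j) a b * (g i * cos (of_int (int k - int j) * node L i)) +
      odd_part T (int k - int j) a b * (g i * sin (of_int (int k - int j) * node L i)))"
      unfolding fejer_kernel_def sum_distrib_left
      by (intro sum.cong refl) (simp only: distrib_left mult.left_commute)
    also have "\<dots> = (\<Sum>j<L. \<Sum>k<L. \<Sum>i<2 * L.
      even_part T (int k - int j) a b * (g i * cos (of_int (int k - int j) * node L i)) +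
      odd_part T (int k - int j) a b * (g i * sin (of_int (int k - int j) * node L i)))"
      by (subst sum.swap, rule sum.cong[OF refl], rule sum.swap)
    finally show ?thesis by (simp only: sum.distrib sum_distrib_left)
  qed
  have n: "\<bar>int n\<bar> < int L" using assms by simp
  note diag = sum_diagonal[OF less_imp_le[OF assms]]
  have swap: "(\<Sum>i<2 * L. sin (of_int m * node L i) * cos (of_int l * node L i)) =
      (\<Sum>i<2 * L. cos (of_int l * node L i) * sin (of_int m * node L i))" for l m :: int
    by (simp only: mult.commute)
  have "(\<Sum>i<2 * L. cos (of_int (int n) * node L i) * fejer_kernel T L (node L i) a b) =
    (\<Sum>j<L. \<Sum>k<L. real L * (even_part T (int k - int j) a b * (if int k - int j = int n then 1 else 0)) +
       real L * (even_part T (int k - int j) a b * (if int k - int j = - int n then 1 else 0)))"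
    unfolding pull
  proof (intro sum.cong refl)
    fix j k assume "j \<in> {..<L}" "k \<in> {..<L}"
    then have "\<bar>int k - int j\<bar> < int L" by auto
    note o = node_orthogonality[OF this n]
    show "even_part T (int k - int j) a b * (\<Sum>i<2 * L. cos (of_int (int n) * node L i) * cos (of_int (int k - int j) * node L i)) +
      odd_part T (int k - int j) a b * (\<Sum>i<2 * L. cos (of_int (int n) * node L i) * sin (of_int (int k - int j) * node L i)) =
      real L * (even_part T (int k - int j) a b * (if int k - int j = int n then 1 else 0)) +
       real L * (even_part T (int k - int j) a b * (if int k - int j = - int n then 1 else 0))"
      unfolding o by (simp only: distrib_left mult_ac mult_zero_right add_0_right)
  qed
  also have "\<dots> = real L * real (L - n) * (even_part T (int n) a b + even_part T (- int n) a b)"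
    by (simp only: sum.distrib sum_distrib_left[symmetric] diag[of "\<lambda>n. even_part T n a b"])
      (simp only: distrib_left right_diff_distrib mult.assoc)
  finally show "(\<Sum>i<2 * L. cos (real n * node L i) * fejer_kernel T L (node L i) a b) =
      real L * real (L - n) * (even_part T (int n) a b + even_part T (- int n) a b)"
    by simp
  have "(\<Sum>i<2 * L. sin (of_int (int n) * node L i) * fejer_kernel T L (node L i) a b) =
    (\<Sum>j<L. \<Sum>k<L. real L * (odd_part T (int k - int j) a b * (if int k - int j = int n then 1 else 0)) -
       real L * (odd_part T (int k - int j) a b * (if int k - int j = - int n then 1 else 0)))"
    unfolding pull
  proof (intro sum.cong refl)
    fix j k assume "j \<in> {..<L}" "k \<in> {..<L}"
    then have l: "\<bar>int k - int j\<bar> < int L" by auto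
    note o = node_orthogonality(2)[OF l n] node_orthogonality(3)[OF n l]
    show "even_part T (int k - int j) a b * (\<Sum>i<2 * L. sin (of_int (int n) * node L i) * cos (of_int (int k - int j) * node L i)) +
      odd_part T (int k - int j) a b * (\<Sum>i<2 * L. sin (of_int (int n) * node L i) * sin (of_int (int k - int j) * node L i)) =
      real L * (odd_part T (int k - int j) a b * (if int k - int j = int n then 1 else 0)) -
       real L * (odd_part T (int k - int j) a b * (if int k - int j = - int n then 1 else 0))"
      unfolding swap o by (simp only: right_diff_distrib mult_ac mult_zero_right add_0_left)
  qed
  also have "\<dots> = real L * real (L - n) * (odd_part T (int n) a b - odd_part T (- int n) a b)"
    by (simp only: sum_subtractf sum_distrib_left[symmetric] diag[of "\<lambda>n. odd_part T n a b"])
      (simp only: distrib_left right_diff_distrib mult.assoc)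
  finally show "(\<Sum>i<2 * L. sin (real n * node L i) * fejer_kernel T L (node L i) a b) =
      real L * real (L - n) * (odd_part T (int n) a b - odd_part T (- int n) a b)"
    by simp
qed

text \<open>  Extend the Toeplitz sequence to length \<open>L\<close>. Its Fejer kernels at the nodes are positive
  semidefinite \<open>4 \<times> 4\<close> matrices, hence sums of rank-one terms, and their trigonometric moments of
  order at most \<open>N\<close> are the original \<open>X\<^sub>n\<close> and \<open>Y\<^sub>n\<close> with the factor \<open>1 - n / L\<close>.\<close>

lemma fejer_means_are_moments:
  fixes X Y :: "nat \<Rightarrow> real^4^4"
  assumes psd: "psd_on ({0..N} \<times> UNIV)
       (\<lambda>r s. block_toeplitz X r s + block_hankel (hankel_seq N Y) r s)"
    and X: "\<And>n. n \<le> N \<Longrightarrow> transpose (X n) = X n"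
    and Y: "\<And>n. n \<in> {1..N} \<Longrightarrow> transpose (Y n) = Y n" and Y0: "Y 0 = 0"
    and L: "N < L"
  obtains q :: "nat \<times> 4 \<Rightarrow> real^4" where
    "\<And>n. n \<le> N \<Longrightarrow> (\<Sum>k\<in>{..<2 * L} \<times> UNIV. cos (real n * node L (fst k)) *\<^sub>R outer (q k)) =
       (real (L - n) / real L) *\<^sub>R X n"
    "\<And>n. n \<le> N \<Longrightarrow> (\<Sum>k\<in>{..<2 * L} \<times> UNIV. sin (real n * node L (fst k)) *\<^sub>R outer (q k)) =
       (real (L - n) / real L) *\<^sub>R Y n"
proof -
  define M where "M = L - 1"
  then have M: "L = Suc M" "N + (M - N) = M"
    using L by simp_all
  obtain T where T: "psd_on ({..M} \<times> UNIV) (toeplitz_kernel T)"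
    "\<And>n. \<bar>n\<bar> \<le> int N \<Longrightarrow> T n = complex_blocks X Y n"
    using psd_toeplitz_extend[OF psd_complex_blocks[OF psd X Y], of "M - N"] unfolding M(2) by blast
  have fejer: "psd_on UNIV (fejer_kernel T L (node L i))" for i
    unfolding M(1) by (rule psd_fejer_kernel[OF T(1)])
  have "\<exists>w. \<forall>a b. fejer_kernel T L (node L i) a b = (\<Sum>k\<in>(UNIV :: 4 set). w k a * w k b)" for i
    using psd_on_factor[OF finite fejer[of i]] by simp
  then obtain w where
    w: "\<And>i a b. fejer_kernel T L (node L i) a b = (\<Sum>k\<in>(UNIV :: 4 set). w i k a * w i k b)"
    by metis
  \<comment> \<open>The factor \<open>1 / (2 L)\<close> turns the total weight \<open>4
    L\<^sup>2\<close> of the node sums into \<open>1\<close>.\<close>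
  define q :: "nat \<times> 4 \<Rightarrow> real^4" where "q = (\<lambda>(i, k). \<chi> a. w i k a / (2 * real L))"
  have sum_q: "(\<Sum>k\<in>{..<2 * L} \<times> UNIV. g (fst k) *\<^sub>R outer (q k)) $ a $ b =
      (\<Sum>i<2 * L. g i * fejer_kernel T L (node L i) a b) / (4 * (real L)\<^sup>2)" for g a b
  proof -
    have "(\<Sum>k\<in>{..<2 * L} \<times> UNIV. g (fst k) *\<^sub>R outer (q k)) $ a $ b =
        (\<Sum>i<2 * L. \<Sum>k\<in>UNIV. g i * (w i k a * w i k b / (4 * (real L)\<^sup>2)))"
      by (simp add: sum.cartesian_product split_beta' outer_def q_def power2_eq_square)
    also have "\<dots> = (\<Sum>i<2 * L. g i * fejer_kernel T L (node L i) a b) / (4 * (real L)\<^sup>2)"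
      unfolding w by (simp add: sum_divide_distrib sum_distrib_left)
    finally show ?thesis .
  qed
  show ?thesis
  proof (rule that)
    fix n assume n: "n \<le> N"
    have T': "T (int n) = complex_blocks X Y (int n)" "T (- int n) = complex_blocks X Y (- int n)"
      using n by (simp_all add: T(2))
    have nL: "n < L" using n L by simp
    note moments = fejer_kernel_moments[OF nL, of T]
    have even: "even_part T (int n) a b + even_part T (- int n) a b = 4 * X n $ a $ b" for a b
      unfolding even_part_def T' by (simp add: complex_blocks_def)
    have odd: "odd_part T (int n) a b - odd_part T (- int n) a b = 4 * Y n $ a $ b" for a b
      unfolding odd_part_def T' by (cases "n = 0") (simp_all add: complex_blocks_def Y0)
    have cancel: "real L * real (L - n) * (4 * x) / (4 * (real L)\<^sup>2) = real (L - n) / real L * x" for x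
      using L by (simp add: power2_eq_square)
    show "(\<Sum>k\<in>{..<2 * L} \<times> UNIV. cos (real n * node L (fst k)) *\<^sub>R outer (q k)) =
       (real (L - n) / real L) *\<^sub>R X n"
      by (simp only: vec_eq_iff sum_q[of "\<lambda>i. cos (real n * node L i)"] moments even cancel
          vector_scaleR_component real_scaleR_def simp_thms)
    show "(\<Sum>k\<in>{..<2 * L} \<times> UNIV. sin (real n * node L (fst k)) *\<^sub>R outer (q k)) =
       (real (L - n) / real L) *\<^sub>R Y n"
      by (simp only: vec_eq_iff sum_q[of "\<lambda>i. sin (real n * node L i)"] moments odd cancel
          vector_scaleR_component real_scaleR_def simp_thms)
  qed
qed

section \<open>Bounding the number of terms and passing to the limit\<close>

lemma linear_system_nontrivial_solution:
  fixes f :: "'i \<Rightarrow> 'c \<Rightarrow> real"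
  assumes "finite C" "finite I" "card C < card I"
  shows "\<exists>u. (\<exists>i\<in>I. u i \<noteq> 0) \<and> (\<forall>c\<in>C. (\<Sum>i\<in>I. u i * f i c) = 0)"
  using assms
proof (induction C arbitrary: I f rule: finite_induct)
  case empty
  then have "I \<noteq> {}" by auto
  then show ?case by (intro exI[of _ "\<lambda>_. 1"]) auto
next
  case (insert c C)
  show ?case
  proof (cases "\<forall>i\<in>I. f i c = 0")
    case True
    obtain u where "\<exists>i\<in>I. u i \<noteq> 0" "\<forall>c\<in>C. (\<Sum>i\<in>I. u i * f i c) = 0"
      using insert.IH[of I f] insert.prems insert.hyps by auto
    with True show ?thesis by (intro exI[of _ u]) auto
  next
    case False
    then obtain p where p: "p \<in> I" "f p c \<noteq> 0" by blast
    define g where "g i d = f i d - f i c / f p c * f p d" for i d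
    obtain u where u: "\<exists>i\<in>I - {p}. u i \<noteq> 0" "\<And>d. d \<in> C \<Longrightarrow> (\<Sum>i\<in>I - {p}. u i * g i d) = 0"
    proof -
      have "finite (I - {p})" "card C < card (I - {p})"
        using insert.prems insert.hyps p(1) by simp_all
      from insert.IH[OF this, of g] show ?thesis using that by blast
    qed
    define u' where "u' = u(p := - (\<Sum>i\<in>I - {p}. u i * f i c) / f p c)"
    have split: "(\<Sum>i\<in>I. u' i * f i d) =
        (\<Sum>i\<in>I - {p}. u i * f i d) - (\<Sum>i\<in>I - {p}. u i * f i c) / f p c * f p d" for d
    proof -
      have "(\<Sum>i\<in>I. u' i * f i d) = u' p * f p d + (\<Sum>i\<in>I - {p}. u' i * f i d)"
        using insert.prems(1) p(1) by (rule sum.remove)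
      also have "(\<Sum>i\<in>I - {p}. u' i * f i d) = (\<Sum>i\<in>I - {p}. u i * f i d)"
        by (intro sum.cong) (auto simp: u'_def)
      finally show ?thesis by (simp add: u'_def)
    qed
    have "(\<Sum>i\<in>I. u' i * f i d) = 0" if "d \<in> insert c C" for d
    proof (cases "d = c")
      case True
      then show ?thesis using p(2) by (simp add: split)
    next
      case False
      have "(\<Sum>i\<in>I. u' i * f i d) = (\<Sum>i\<in>I - {p}. u i * g i d)"
        unfolding split g_def sum_distrib_right sum_divide_distrib sum_subtractf[symmetric]
        by (intro sum.cong refl) (simp add: algebra_simps)
      then show ?thesis using u(2) that False by simp
    qed
    moreover have "\<exists>i\<in>I. u' i \<noteq> 0"
      using u(1) by (auto simp: u'_def)
    ultimately show ?thesis by blast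
  qed
qed

text \<open>  As long as there are more vectors than coordinates, a linear dependence can be subtracted with
  the largest multiple that keeps all weights nonnegative, which removes one vector.\<close>

lemma conic_caratheodory:
  fixes f :: "'i \<Rightarrow> 'c \<Rightarrow> real"
  assumes "finite C" "finite I" "\<And>i. i \<in> I \<Longrightarrow> 0 \<le> l i"
  shows "\<exists>J l'. J \<subseteq> I \<and> card J \<le> card C \<and> (\<forall>i\<in>J. 0 \<le> l' i) \<and>
    (\<forall>c\<in>C. (\<Sum>i\<in>J. l' i * f i c) = (\<Sum>i\<in>I. l i * f i c))"
  using assms(2,3)
proof (induction "card I" arbitrary: I l rule: less_induct)
  case less
  show ?case
  proof (cases "card I \<le> card C")
    case True
    then show ?thesis using less.prems by blast
  next
    case False
    then obtain u where u: "\<exists>i\<in>I. u i \<noteq> 0" "\<forall>c\<in>C. (\<Sum>i\<in>I. u i * f i c) = 0"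
      using linear_system_nontrivial_solution[OF assms(1) less.prems(1), of f] by auto
    obtain v where v: "\<exists>i\<in>I. v i > 0" "\<forall>c\<in>C. (\<Sum>i\<in>I. v i * f i c) = 0"
    proof (cases "\<exists>i\<in>I. u i > 0")
      case True
      then show ?thesis using that u by blast
    next
      case False
      with u(1) have "\<exists>i\<in>I. - u i > 0" by (metis linorder_neqE_linordered_idom neg_0_less_iff_less)
      moreover have "\<forall>c\<in>C. (\<Sum>i\<in>I. - u i * f i c) = 0"
        using u(2) by (simp add: sum_negf)
      ultimately show ?thesis using that[of "\<lambda>i. - u i"] by blast
    qed
    define P where "P = {i \<in> I. v i > 0}"
    have P: "finite P" "P \<noteq> {}" using less.prems(1) v(1) by (auto simp: P_def)
    then obtain p where p: "p \<in> P" "\<And>i. i \<in> P \<Longrightarrow> l p / v p \<le> l i / v i"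
      using arg_min_if_finite[OF P, of "\<lambda>i. l i / v i"]
      by (metis (mono_tags, lifting) linorder_not_less)
    define t where "t = l p / v p"
    have pI: "p \<in> I" "v p > 0" using p(1) by (auto simp: P_def)
    have t: "0 \<le> t" using less.prems(2) pI by (simp add: t_def)
    define l' where "l' i = l i - t * v i" for i
    have nonneg: "0 \<le> l' i" if "i \<in> I" for i
    proof (cases "v i > 0")
      case True
      then have "t \<le> l i / v i" using p(2) that by (simp add: P_def t_def)
      then show ?thesis using True by (simp add: l'_def field_simps)
    next
      case False
      then have "t * v i \<le> 0" using t by (simp add: mult_nonneg_nonpos)
      then show ?thesis using less.prems(2)[OF that] by (simp add: l'_def)
    qed
    have "l' p = 0" using pI by (simp add: l'_def t_def)
    have same: "(\<Sum>i\<in>I - {p}. l' i * f i c) = (\<Sum>i\<in>I. l i * f i c)" if "c \<in> C" for c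
    proof -
      have "(\<Sum>i\<in>I - {p}. l' i * f i c) = (\<Sum>i\<in>I. l' i * f i c)"
        using less.prems(1) pI \<open>l' p = 0\<close> by (simp add: sum.remove)
      also have "\<dots> = (\<Sum>i\<in>I. l i * f i c) - t * (\<Sum>i\<in>I. v i * f i c)"
        by (simp add: l'_def left_diff_distrib sum_subtractf sum_distrib_left mult.assoc)
      finally show ?thesis using v(2) that by simp
    qed
    have "card (I - {p}) < card I"
      using less.prems(1) pI(1) by (rule card_Diff1_less)
    from less.hyps[OF this, of l'] less.prems(1) nonneg
    obtain J l'' where "J \<subseteq> I - {p}" "card J \<le> card C" "\<forall>i\<in>J. 0 \<le> l'' i"
      "\<forall>c\<in>C. (\<Sum>i\<in>J. l'' i * f i c) = (\<Sum>i\<in>I - {p}. l' i * f i c)"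
      by auto
    then show ?thesis using same by (intro exI[of _ J] exI[of _ l'']) auto
  qed
qed

lemma outer_scaleR: "outer (c *\<^sub>R q) = c\<^sup>2 *\<^sub>R outer q"
  by (simp add: outer_def vec_eq_iff power2_eq_square)

lemma outer_zero [simp]: "outer 0 = 0"
  by (simp add: outer_def vec_eq_iff)

lemma trace_outer: "trace (outer q) = (norm q)\<^sup>2"
  by (simp add: trace_def outer_def power2_norm_eq_inner inner_vec_def)

text \<open>  The bound \<open>D\<close> does not depend on the given representation, so representations of different
  points can be compared term by term in a compactness argument. Weights are absorbed into the
  vectors.\<close>

lemma moment_sum_few_terms:
  fixes q :: "'k \<Rightarrow> real^4" and \<theta> :: "'k \<Rightarrow> real"
  assumes "finite K" "D = card ({..N} \<times> (UNIV :: (bool \<times> 4 \<times> 4) set))"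
    and \<theta>: "\<And>k. k \<in> K \<Longrightarrow> \<theta> k \<in> {-pi..pi}"
  obtains z :: "nat \<Rightarrow> (real^4) \<times> real" where
    "\<And>n. n \<le> N \<Longrightarrow> (\<Sum>k<D. cos (real n * snd (z k)) *\<^sub>R outer (fst (z k))) =
       (\<Sum>k\<in>K. cos (real n * \<theta> k) *\<^sub>R outer (q k))"
    "\<And>n. n \<le> N \<Longrightarrow> (\<Sum>k<D. sin (real n * snd (z k)) *\<^sub>R outer (fst (z k))) =
       (\<Sum>k\<in>K. sin (real n * \<theta> k) *\<^sub>R outer (q k))"
    "\<And>k. snd (z k) \<in> {-pi..pi}"
    "\<And>k. k \<ge> D \<Longrightarrow> z k = (0, 0)"
proof -
  define C where "C = {..N} \<times> (UNIV :: (bool \<times> 4 \<times> 4) set)"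
  define trig where "trig = (\<lambda>\<alpha> x. if \<alpha> then sin x else cos (x :: real))"
  define f where "f k = (\<lambda>(n, \<alpha>, a, b). trig \<alpha> (real n * \<theta> k) * outer (q k) $ a $ b)" for k
  have D: "D = card C" by (simp only: assms(2) C_def)
  have "finite C" by (simp add: C_def)
  from conic_caratheodory[OF this assms(1), of "\<lambda>_. 1" f]
  have "\<exists>J l. J \<subseteq> K \<and> card J \<le> card C \<and> (\<forall>k\<in>J. 0 \<le> l k) \<and>
      (\<forall>c\<in>C. (\<Sum>k\<in>J. l k * f k c) = (\<Sum>k\<in>K. f k c))" by simp
  then obtain J l where
    J: "J \<subseteq> K" "card J \<le> D" "\<And>k. k \<in> J \<Longrightarrow> 0 \<le> l k"
    and eq: "\<And>c. c \<in> C \<Longrightarrow> (\<Sum>k\<in>J. l k * f k c) = (\<Sum>k\<in>K. f k c)"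
    unfolding D by blast
  have "finite J" using J(1) assms(1) by (rule finite_subset)
  then obtain g where g: "bij_betw g {..<card J} J"
    using ex_bij_betw_nat_finite atLeast0LessThan by metis
  define z where "z k = (if k < card J then (sqrt (l (g k)) *\<^sub>R q (g k), \<theta> (g k)) else (0, 0))" for k
  have sums: "(\<Sum>k<D. trig \<alpha> (real n * snd (z k)) *\<^sub>R outer (fst (z k))) =
       (\<Sum>k\<in>K. trig \<alpha> (real n * \<theta> k) *\<^sub>R outer (q k))" if "n \<le> N" for n \<alpha>
  proof -
    have "(\<Sum>k<D. trig \<alpha> (real n * snd (z k)) *\<^sub>R outer (fst (z k))) =
        (\<Sum>k<card J. trig \<alpha> (real n * snd (z k)) *\<^sub>R outer (fst (z k)))"
      using J(2) by (intro sum.mono_neutral_right) (auto simp: z_def)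
    also have "\<dots> = (\<Sum>k<card J. l (g k) *\<^sub>R trig \<alpha> (real n * \<theta> (g k)) *\<^sub>R outer (q (g k)))"
      using J(3) bij_betwE[OF g]
      by (intro sum.cong refl) (simp add: z_def outer_scaleR mult.commute)
    also have "\<dots> = (\<Sum>k\<in>J. l k *\<^sub>R trig \<alpha> (real n * \<theta> k) *\<^sub>R outer (q k))"
      by (rule sum.reindex_bij_betw[OF g])
    also have "\<dots> = (\<Sum>k\<in>K. trig \<alpha> (real n * \<theta> k) *\<^sub>R outer (q k))"
    proof -
      have "(\<Sum>k\<in>J. l k * (trig \<alpha> (real n * \<theta> k) * outer (q k) $ a $ b)) =
          (\<Sum>k\<in>K. trig \<alpha> (real n * \<theta> k) * outer (q k) $ a $ b)" for a b
        using eq[of "(n, \<alpha>, a, b)"] that by (simp add: f_def C_def)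
      then show ?thesis by (simp add: vec_eq_iff mult.assoc)
    qed
    finally show ?thesis .
  qed
  show ?thesis
  proof (rule that[of z])
    show "snd (z k) \<in> {-pi..pi}" for k
      using \<theta> J(1) bij_betwE[OF g] by (auto simp: z_def)
    show "z k = (0, 0)" if "k \<ge> D" for k
      using that J(2) by (simp add: z_def)
  qed (use sums[of _ False] sums[of _ True] in \<open>simp_all add: trig_def\<close>)
qed

lemma trace_sum: "trace (\<Sum>k\<in>K. f k) = (\<Sum>k\<in>K. trace (f k :: real^'n^'n))"
  unfolding trace_def by (subst sum.swap) simp

lemma tendsto_outer:
  "(f \<longlongrightarrow> q) F \<Longrightarrow> ((\<lambda>i. outer (f i)) \<longlongrightarrow> outer q) F"
  unfolding outer_def by (intro tendsto_vec_lambda tendsto_mult tendsto_vec_nth)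

text \<open>  The Fejer means of a feasible point have representations with a common number \<open>D\<close> of terms, and
  the trace condition confines the vectors to the unit ball. A limit of a convergent
  subsequence of these representations represents the limit of the Fejer means, which is the
  point itself.\<close>

lemma feasible_is_moment_sum:
  assumes "sdp_feasible N (X, Y)"
  obtains D and z :: "nat \<Rightarrow> (real^4) \<times> real" where
    "\<And>n. n \<le> N \<Longrightarrow> X n = (\<Sum>k<D. cos (real n * snd (z k)) *\<^sub>R outer (fst (z k)))"
    "\<And>n. n \<le> N \<Longrightarrow> Y n = (\<Sum>k<D. sin (real n * snd (z k)) *\<^sub>R outer (fst (z k)))"
    "\<And>k. snd (z k) \<in> {-pi..pi}"
proof -
  from assms have feas: "psd_on ({0..N} \<times> UNIV)
       (\<lambda>r s. block_toeplitz X r s + block_hankel (hankel_seq N Y) r s)"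
    "\<And>n. n \<le> N \<Longrightarrow> transpose (X n) = X n" "\<And>n. n \<in> {1..N} \<Longrightarrow> transpose (Y n) = Y n"
    "Y 0 = 0" "trace (X 0) = 1"
    by (auto simp: sdp_feasible_def)
  define D where "D = card ({..N} \<times> (UNIV :: (bool \<times> 4 \<times> 4) set))"
  define c where "c n i = real (Suc (N + i) - n) / real (Suc (N + i))" for n i
  define S :: "(nat \<Rightarrow> (real^4) \<times> real) set" where "S = {z. \<forall>k. z k \<in> cball 0 1 \<times> {-pi..pi}}"
  define good where "good i z \<longleftrightarrow> z \<in> S \<and>
      (\<forall>n\<le>N. (\<Sum>k<D. cos (real n * snd (z k)) *\<^sub>R outer (fst (z k))) = c n i *\<^sub>R X n) \<and>
      (\<forall>n\<le>N. (\<Sum>k<D. sin (real n * snd (z k)) *\<^sub>R outer (fst (z k))) = c n i *\<^sub>R Y n)"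
    for i and z :: "nat \<Rightarrow> (real^4) \<times> real"
  have "\<exists>z. good i z" for i
  proof -
    define L where "L = Suc (N + i)"
    have "N < L" by (simp add: L_def)
    obtain q :: "nat \<times> 4 \<Rightarrow> real^4" where
      q: "\<And>n. n \<le> N \<Longrightarrow> (\<Sum>k\<in>{..<2 * L} \<times> UNIV. cos (real n * node L (fst k)) *\<^sub>R outer (q k)) =
         (real (L - n) / real L) *\<^sub>R X n"
      "\<And>n. n \<le> N \<Longrightarrow> (\<Sum>k\<in>{..<2 * L} \<times> UNIV. sin (real n * node L (fst k)) *\<^sub>R outer (q k)) =
         (real (L - n) / real L) *\<^sub>R Y n"
      by (rule fejer_means_are_moments[OF feas(1-4) \<open>N < L\<close>]) (assumption, assumption, rule that)
    let ?K = "{..<2 * L} \<times> (UNIV :: 4 set)"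
    have fin: "finite ?K" by simp
    have nodes: "node L (fst k) \<in> {-pi..pi}" if "k \<in> ?K" for k
      using that node_range[of "fst k" L] by auto
    obtain z :: "nat \<Rightarrow> (real^4) \<times> real" where
      sums: "\<And>n. n \<le> N \<Longrightarrow> (\<Sum>k<D. cos (real n * snd (z k)) *\<^sub>R outer (fst (z k))) =
         (\<Sum>k\<in>?K. cos (real n * node L (fst k)) *\<^sub>R outer (q k))"
      "\<And>n. n \<le> N \<Longrightarrow> (\<Sum>k<D. sin (real n * snd (z k)) *\<^sub>R outer (fst (z k))) =
         (\<Sum>k\<in>?K. sin (real n * node L (fst k)) *\<^sub>R outer (q k))"
      and range: "\<And>k. snd (z k) \<in> {-pi..pi}" and zero: "\<And>k. k \<ge> D \<Longrightarrow> z k = (0, 0)"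
      by (rule moment_sum_few_terms[where K = ?K and D = D and N = N and
            \<theta> = "\<lambda>k. node L (fst k)" and q = q, OF fin D_def nodes]) (assumption, rule that)
    have z: "(\<Sum>k<D. cos (real n * snd (z k)) *\<^sub>R outer (fst (z k))) = c n i *\<^sub>R X n"
      "(\<Sum>k<D. sin (real n * snd (z k)) *\<^sub>R outer (fst (z k))) = c n i *\<^sub>R Y n" if "n \<le> N" for n
      using sums[OF that] q[OF that] by (simp_all only: c_def L_def)
    \<comment> \<open>At \<open>n = 0\<close> the Fejer factor is \<open>1\<close>, so the trace is
      preserved exactly.\<close>
    have "(\<Sum>k<D. (norm (fst (z k)))\<^sup>2) = trace (\<Sum>k<D. outer (fst (z k)))"
      by (simp add: trace_sum trace_outer)
    also have "\<dots> = 1" using z(1)[of 0] feas(5) by (simp add: c_def)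
    finally have total: "(\<Sum>k<D. (norm (fst (z k)))\<^sup>2) = 1" .
    have "norm (fst (z k)) \<le> 1" for k
    proof (cases "k < D")
      case True
      then have "(norm (fst (z k)))\<^sup>2 \<le> (\<Sum>k<D. (norm (fst (z k)))\<^sup>2)"
        by (intro member_le_sum) auto
      then show ?thesis using total by (simp add: power2_le_imp_le abs_square_le_1)
    qed (simp add: zero)
    then have "z \<in> S" using range by (simp add: S_def mem_Times_iff)
    with z show ?thesis by (auto simp: good_def)
  qed
  then obtain Z where Z: "\<And>i. good i (Z i)" by metis
  have "compact S"
  proof -
    have "S = PiE UNIV (\<lambda>_. cball 0 1 \<times> {-pi..pi})" by (auto simp: S_def PiE_def Pi_def)
    moreover have "compactin (product_topology (\<lambda>_. euclidean) UNIV)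
        (PiE UNIV (\<lambda>_::nat. cball (0::real^4) 1 \<times> {-pi..pi}))"
      unfolding compactin_PiE by (simp add: compact_Times)
    ultimately show ?thesis by (simp add: euclidean_product_topology)
  qed
  then obtain z r where z: "z \<in> S" and r: "strict_mono r" "(Z \<circ> r) \<longlonglongrightarrow> z"
    using seq_compactE[of S Z] Z unfolding compact_eq_seq_compact_metric good_def by metis
  have coord: "(\<lambda>i. Z (r i) k) \<longlonglongrightarrow> z k" for k
    using continuous_on_tendsto_compose[OF continuous_on_product_coordinates[of k] r(2)] by simp
  have c: "(\<lambda>i. c n (r i)) \<longlonglongrightarrow> 1" if "n \<le> N" for n
  proof -
    have "c n = (\<lambda>i. 1 - real n / real (i + Suc N))"
      using that by (simp add: fun_eq_iff c_def field_simps of_nat_diff)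
    moreover have "(\<lambda>i. 1 - real n / real (i + Suc N)) \<longlonglongrightarrow> 1 - 0"
      by (intro tendsto_diff tendsto_const LIMSEQ_ignore_initial_segment[OF lim_const_over_n])
    ultimately have "c n \<longlonglongrightarrow> 1" by simp
    from LIMSEQ_subseq_LIMSEQ[OF this r(1)] show ?thesis by (simp add: comp_def)
  qed
  show ?thesis
  proof (rule that)
    fix n assume n: "n \<le> N"
    have limit1: "(\<lambda>i. \<Sum>k<D. cos (real n * snd (Z (r i) k)) *\<^sub>R outer (fst (Z (r i) k)))
        \<longlonglongrightarrow> (\<Sum>k<D. cos (real n * snd (z k)) *\<^sub>R outer (fst (z k)))"
      by (intro tendsto_sum tendsto_scaleR tendsto_cos tendsto_mult tendsto_const
          tendsto_fst tendsto_snd tendsto_outer coord)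
    have eq1: "(\<Sum>k<D. cos (real n * snd (Z (r i) k)) *\<^sub>R outer (fst (Z (r i) k))) = c n (r i) *\<^sub>R X n" for i
      using Z[of "r i"] n by (simp only: good_def)
    have "(\<lambda>i. c n (r i) *\<^sub>R X n) \<longlonglongrightarrow> 1 *\<^sub>R X n"
      by (intro tendsto_scaleR c[OF n] tendsto_const)
    from LIMSEQ_unique[OF this limit1[unfolded eq1]]
    show "X n = (\<Sum>k<D. cos (real n * snd (z k)) *\<^sub>R outer (fst (z k)))"
      by (simp only: scaleR_one)
    have limit2: "(\<lambda>i. \<Sum>k<D. sin (real n * snd (Z (r i) k)) *\<^sub>R outer (fst (Z (r i) k)))
        \<longlonglongrightarrow> (\<Sum>k<D. sin (real n * snd (z k)) *\<^sub>R outer (fst (z k)))"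
      by (intro tendsto_sum tendsto_scaleR tendsto_sin tendsto_mult tendsto_const
          tendsto_fst tendsto_snd tendsto_outer coord)
    have eq2: "(\<Sum>k<D. sin (real n * snd (Z (r i) k)) *\<^sub>R outer (fst (Z (r i) k))) = c n (r i) *\<^sub>R Y n" for i
      using Z[of "r i"] n by (simp only: good_def)
    have "(\<lambda>i. c n (r i) *\<^sub>R Y n) \<longlonglongrightarrow> 1 *\<^sub>R Y n"
      by (intro tendsto_scaleR c[OF n] tendsto_const)
    from LIMSEQ_unique[OF this limit2[unfolded eq2]]
    show "Y n = (\<Sum>k<D. sin (real n * snd (z k)) *\<^sub>R outer (fst (z k)))"
      by (simp only: scaleR_one)
  next
    fix k show "snd (z k) \<in> {-pi..pi}" using z by (auto simp: S_def mem_Times_iff)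
  qed
qed

section \<open>The feasible set is the convex hull of the moment points\<close>

text \<open>  Splitting each vector of the representation into its squared norm and its direction gives
  weights and unit quaternions; the trace condition says that the weights add up to \<open>1\<close>.\<close>

lemma feasible_in_conv_moment_points:
  assumes "sdp_feasible N p"
  shows "p \<in> conv {moment_point N q \<omega> | q \<omega>. q \<in> sphere 0 1 \<and> \<omega> \<in> {-pi..<pi}}"
proof -
  obtain X Y where p: "p = (X, Y)" by (cases p)
  obtain D and z :: "nat \<Rightarrow> (real^4) \<times> real" where
    z: "\<And>n. n \<le> N \<Longrightarrow> X n = (\<Sum>k<D. cos (real n * snd (z k)) *\<^sub>R outer (fst (z k)))"
    "\<And>n. n \<le> N \<Longrightarrow> Y n = (\<Sum>k<D. sin (real n * snd (z k)) *\<^sub>R outer (fst (z k)))"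
    and range: "\<And>k. snd (z k) \<in> {-pi..pi}"
    by (rule feasible_is_moment_sum[OF assms[unfolded p]]) (rule that)
  have zero: "X n = 0" if "n \<notin> {0..N}" for n
    using assms that unfolding p sdp_feasible_def by simp
  have zero': "Y n = 0" if "n \<notin> {1..N}" for n
    using assms that unfolding p sdp_feasible_def by simp
  define u where "u k = (norm (fst (z k)))\<^sup>2" for k
  \<comment> \<open>A zero vector gets weight \<open>0\<close> and an arbitrary direction; the angle
    \<open>\<pi>\<close> becomes \<open>- \<pi>\<close>, which is in the half-open interval.\<close>
  define q where "q k = (if fst (z k) = 0 then axis 1 1 else (1 / norm (fst (z k))) *\<^sub>R fst (z k))" for k
  define \<omega> where "\<omega> k = (if snd (z k) = pi then - pi else snd (z k))" for k
  have q: "u k *\<^sub>R outer (q k) = outer (fst (z k))" "norm (q k) = 1" for k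
    by (simp_all add: u_def q_def outer_scaleR power_divide)
  have rescale: "(u k * c) *\<^sub>R outer (q k) = c *\<^sub>R outer (fst (z k))" for k c
    by (simp only: mult.commute[of "u k"] scaleR_scaleR[symmetric] q)
  have trig: "cos (real n * \<omega> k) = cos (real n * snd (z k))" "sin (real n * \<omega> k) = sin (real n * snd (z k))"
    for n k by (simp_all add: \<omega>_def)
  have "X n = (\<Sum>k<D. u k *\<^sub>R fst (moment_point N (q k) (\<omega> k)) n)" for n
  proof (cases "n \<le> N")
    case True
    then show ?thesis by (simp add: z moment_point_def trig rescale)
  qed (simp add: zero moment_point_def)
  moreover have "Y n = (\<Sum>k<D. u k *\<^sub>R snd (moment_point N (q k) (\<omega> k)) n)" for n
  proof (cases "n \<in> {1..N}")
    case True
    then show ?thesis by (simp add: z moment_point_def trig rescale)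
  next
    case False
    then have "snd (moment_point N (q k) (\<omega> k)) n = 0" for k
      unfolding moment_point_def by (simp only: snd_conv if_False)
    then show ?thesis using zero'[OF False] by simp
  qed
  moreover have "(\<Sum>k<D. u k) = 1"
  proof -
    have "(\<Sum>k<D. u k) = trace (\<Sum>k<D. outer (fst (z k)))"
      by (simp add: trace_sum trace_outer u_def)
    also have "(\<Sum>k<D. outer (fst (z k))) = X 0" using z(1)[of 0] by simp
    also have "trace (X 0) = 1" using assms by (simp add: p sdp_feasible_def)
    finally show ?thesis .
  qed
  moreover have "moment_point N (q k) (\<omega> k) \<in>
      {moment_point N q \<omega> | q \<omega>. q \<in> sphere 0 1 \<and> \<omega> \<in> {-pi..<pi}}" for k
    using q(2)[of k] range[of k]
    by (intro CollectI exI[of _ "q k"] exI[of _ "\<omega> k"]) (auto simp: \<omega>_def)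
  moreover have "0 \<le> u k" for k by (simp add: u_def)
  ultimately show ?thesis
    unfolding conv_def p
    by (intro CollectI exI[of _ D] exI[of _ u] exI[of _ "\<lambda>k. moment_point N (q k) (\<omega> k)"])
      (simp only: fun_eq_iff prod.inject simp_thms)
qed

lemma psd_on_rank_one: "psd_on I (\<lambda>r s. w r * w s)"
  unfolding psd_on_def
proof (intro conjI allI)
  fix v
  have "(\<Sum>r\<in>I. \<Sum>s\<in>I. v r * (w r * w s) * v s) = (\<Sum>r\<in>I. v r * w r)\<^sup>2"
    by (simp add: power2_eq_square sum_product mult_ac)
  then show "0 \<le> (\<Sum>r\<in>I. \<Sum>s\<in>I. v r * (w r * w s) * v s)" by simp
qed simp

lemma psd_on_combination:
  assumes "\<And>i. i < m \<Longrightarrow> 0 \<le> u i" "\<And>i. i < m \<Longrightarrow> psd_on I (M i)"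
  shows "psd_on I (\<lambda>r s. \<Sum>i<(m::nat). u i * M i r s)"
  unfolding psd_on_def
proof (intro conjI allI ballI)
  fix v
  have "(\<Sum>r\<in>I. \<Sum>s\<in>I. v r * (\<Sum>i<m. u i * M i r s) * v s) =
      (\<Sum>r\<in>I. \<Sum>s\<in>I. \<Sum>i<m. u i * (v r * M i r s * v s))"
    by (simp add: sum_distrib_left sum_distrib_right mult_ac)
  also have "\<dots> = (\<Sum>i<m. u i * (\<Sum>r\<in>I. \<Sum>s\<in>I. v r * M i r s * v s))"
    by (simp only: sum.swap[of _ "{..<m}" I] sum_distrib_left)
  also have "\<dots> \<ge> 0"
    by (intro sum_nonneg mult_nonneg_nonneg[OF _ psd_onD]) (use assms in auto)
  finally show "0 \<le> (\<Sum>r\<in>I. \<Sum>s\<in>I. v r * (\<Sum>i<m. u i * M i r s) * v s)" .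
qed (use assms(2) in \<open>auto simp: psd_on_def intro!: sum.cong\<close>)

text \<open>  With \<open>\<theta>\<^sub>j = (j - N/2) \<omega>\<close> the Toeplitz part is \<open>cos(\<theta>\<^sub>k - \<theta>\<^sub>j) q q\<^sup>T\<close> and the Hankel part is
  \<open>- sin(\<theta>\<^sub>j + \<theta>\<^sub>k) q q\<^sup>T\<close>. Their sum factors as
  \<open>(cos \<theta>\<^sub>j - sin \<theta>\<^sub>j) (cos \<theta>\<^sub>k - sin \<theta>\<^sub>k) q q\<^sup>T\<close>, so the constraint matrix has rank one.\<close>

lemma moment_point_feasible:
  assumes "norm q = 1"
  shows "sdp_feasible N (moment_point N q \<omega>)"
proof -
  define X where "X n = (if n \<in> {0..N} then cos (real n * \<omega>) *\<^sub>R outer q else 0)" for n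
  define Y where "Y n = (if n \<in> {1..N} then sin (real n * \<omega>) *\<^sub>R outer q else 0)" for n
  define \<theta> where "\<theta> j = (real j - real N / 2) * \<omega>" for j :: nat
  define w where "w = (\<lambda>(j, a). (cos (\<theta> j) - sin (\<theta> j)) * q $ a)"
  let ?I = "{0..N} \<times> (UNIV :: 4 set)"
  have "block_toeplitz X r s + block_hankel (hankel_seq N Y) r s = w r * w s"
    if "r \<in> ?I" "s \<in> ?I" for r s
  proof -
    obtain j a k b where rs: "r = (j, a)" "s = (k, b)" by (cases r, cases s) auto
    with that have jk: "j \<le> N" "k \<le> N" by auto
    have "block_toeplitz X r s = cos (\<theta> k - \<theta> j) * (q $ a * q $ b)"
    proof (cases "j \<le> k")
      case True
      moreover have "real (k - j) * \<omega> = \<theta> k - \<theta> j"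
        using True by (simp add: \<theta>_def of_nat_diff algebra_simps)
      ultimately show ?thesis using jk by (simp add: rs block_toeplitz_def X_def outer_def)
    next
      case False
      moreover have "real (j - k) * \<omega> = - (\<theta> k - \<theta> j)"
        using False by (simp add: \<theta>_def of_nat_diff algebra_simps)
      ultimately show ?thesis using jk
        by (simp add: rs block_toeplitz_def X_def outer_def transpose_def cos_minus del: minus_diff_eq)
    qed
    moreover have "block_hankel (hankel_seq N Y) r s = - sin (\<theta> j + \<theta> k) * (q $ a * q $ b)"
    proof -
      have sum: "\<theta> j + \<theta> k = (real j + real k - real N) * \<omega>"
        by (simp add: \<theta>_def algebra_simps)
      consider "j + k < N" | "j + k = N" | "j + k > N" by linarith
      then show ?thesis
      proof cases
        case 1
        then have "real (N - (j + k)) * \<omega> = - (\<theta> j + \<theta> k)"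
          by (simp add: sum of_nat_diff algebra_simps)
        then have "sin (real (N - (j + k)) * \<omega>) = - sin (\<theta> j + \<theta> k)"
          by (simp only: sin_minus)
        with 1 show ?thesis by (simp add: rs block_hankel_def hankel_seq_def Y_def outer_def)
      next
        case 2
        then have "\<theta> j + \<theta> k = 0" by (simp add: sum)
        with 2 show ?thesis by (auto simp: rs block_hankel_def hankel_seq_def)
      next
        case 3
        then have "real (j + k - N) * \<omega> = \<theta> j + \<theta> k" by (simp add: sum of_nat_diff)
        moreover have "j + k - N \<in> {1..N}" using 3 jk by auto
        ultimately show ?thesis using 3 by (simp add: rs block_hankel_def hankel_seq_def Y_def outer_def)
      qed
    qed
    ultimately show ?thesis
      by (simp add: rs w_def cos_diff sin_add algebra_simps)
  qed
  then have "psd_on ?I (\<lambda>r s. block_toeplitz X r s + block_hankel (hankel_seq N Y) r s) \<longleftrightarrow>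
      psd_on ?I (\<lambda>r s. w r * w s)"
    by (rule psd_on_cong)
  then have "psd_on ?I (\<lambda>r s. block_toeplitz X r s + block_hankel (hankel_seq N Y) r s)"
    by (simp add: psd_on_rank_one)
  moreover have "transpose (outer q) = outer q"
    by (simp add: transpose_def outer_def vec_eq_iff mult.commute)
  then have "transpose (c *\<^sub>R outer q) = c *\<^sub>R outer q" for c
    by (simp add: transpose_def vec_eq_iff)
  ultimately show ?thesis
    using assms unfolding sdp_feasible_def moment_point_def X_def[abs_def] Y_def[abs_def]
    by (simp add: trace_outer)
qed

lemma feasible_combination:
  assumes u: "\<And>i. i < m \<Longrightarrow> 0 \<le> u i" "(\<Sum>i<(m::nat). u i) = 1"
    and p: "\<And>i. i < m \<Longrightarrow> sdp_feasible N (p i)"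
  shows "sdp_feasible N (\<lambda>n. \<Sum>i<m. u i *\<^sub>R fst (p i) n, \<lambda>n. \<Sum>i<m. u i *\<^sub>R snd (p i) n)"
proof -
  define X where "X n = (\<Sum>i<m. u i *\<^sub>R fst (p i) n)" for n
  define Y where "Y n = (\<Sum>i<m. u i *\<^sub>R snd (p i) n)" for n
  let ?I = "{0..N} \<times> (UNIV :: 4 set)"
  let ?M = "\<lambda>i r s. block_toeplitz (fst (p i)) r s + block_hankel (hankel_seq N (snd (p i))) r s"
  have p': "\<And>n. n \<notin> {0..N} \<Longrightarrow> fst (p i) n = 0" "\<And>n. n \<notin> {1..N} \<Longrightarrow> snd (p i) n = 0"
    "\<And>n. n \<in> {0..N} \<Longrightarrow> transpose (fst (p i) n) = fst (p i) n"
    "\<And>n. n \<in> {1..N} \<Longrightarrow> transpose (snd (p i) n) = snd (p i) n"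
    "psd_on ?I (?M i)" "trace (fst (p i) 0) = 1" if "i < m" for i
    using p[OF that] unfolding sdp_feasible_def case_prod_beta by blast+
  have "block_toeplitz X r s + block_hankel (hankel_seq N Y) r s = (\<Sum>i<m. u i * ?M i r s)" for r s
    by (cases r; cases s) (simp add: block_toeplitz_def block_hankel_def hankel_seq_def X_def Y_def
        transpose_def sum.distrib distrib_left sum_negf)
  then have "psd_on ?I (\<lambda>r s. block_toeplitz X r s + block_hankel (hankel_seq N Y) r s)"
    using psd_on_combination[of m u ?I ?M] u(1) p'(5) by simp
  moreover have "transpose (\<Sum>i<m. u i *\<^sub>R Z i) = (\<Sum>i<m. u i *\<^sub>R transpose (Z i))"
    for Z :: "nat \<Rightarrow> real^4^4"
    by (simp add: transpose_def vec_eq_iff)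
  moreover have "trace (X 0) = (\<Sum>i<m. u i * trace (fst (p i) 0))"
    unfolding X_def trace_sum by (simp add: trace_def sum_distrib_left)
  ultimately have "sdp_feasible N (X, Y)"
    using u(2) p'(1-4,6) by (simp add: sdp_feasible_def X_def Y_def)
  then show ?thesis by (simp add: X_def[abs_def] Y_def[abs_def])
qed

lemma mat_inner_eq_sum: "mat_inner X Y = (\<Sum>i\<in>UNIV. \<Sum>j\<in>UNIV. X $ j $ i * Y $ j $ i)"
  by (simp add: mat_inner_def trace_def matrix_matrix_mult_def transpose_def)

lemma mat_inner_combination:
  "mat_inner A (\<Sum>i<m. u i *\<^sub>R Z i) = (\<Sum>i<(m::nat). u i * mat_inner A (Z i))"
proof -
  have "mat_inner A (\<Sum>i<m. u i *\<^sub>R Z i) =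
      (\<Sum>k\<in>UNIV. \<Sum>j\<in>UNIV. \<Sum>i<m. u i * (A $ j $ k * Z i $ j $ k))"
    by (simp add: mat_inner_eq_sum sum_distrib_left mult.left_commute)
  also have "\<dots> = (\<Sum>i<m. u i * mat_inner A (Z i))"
    by (simp only: sum.swap[of _ "{..<m}" UNIV] mat_inner_eq_sum sum_distrib_left)
  finally show ?thesis .
qed

lemma sdp_objective_combination:
  "sdp_objective N A B (\<lambda>n. \<Sum>i<m. u i *\<^sub>R fst (p i) n, \<lambda>n. \<Sum>i<(m::nat). u i *\<^sub>R snd (p i) n) =
     (\<Sum>i<m. u i * sdp_objective N A B (p i))"
proof -
  have swap: "(\<Sum>n=1..N. \<Sum>i<m. g n i) = (\<Sum>i<m. \<Sum>n=1..N. g n i)" for g :: "nat \<Rightarrow> nat \<Rightarrow> real"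
    by (rule sum.swap)
  show ?thesis
    by (simp only: sdp_objective_def case_prod_beta fst_conv snd_conv mat_inner_combination
      distrib_left sum.distrib sum_distrib_left swap)
qed

lemma sdp_objective_moment_point:
  "sdp_objective N A B (moment_point N q \<omega>) = tw_objective N A B (\<omega>, calA (outer q))"
proof -
  have adj: "mat_inner (calA_adj Y) (c *\<^sub>R outer q) = mat_inner Y (c *\<^sub>R calA (outer q))" for Y c
  proof -
    have sym: "transpose (outer q) = outer q"
      by (simp add: transpose_def outer_def vec_eq_iff mult.commute)
    have "mat_inner (calA_adj Y) (c *\<^sub>R outer q) = c * mat_inner (outer q) (calA_adj Y)"
      by (simp add: mat_inner_eq_sum sum_distrib_left mult_ac)
    also have "\<dots> = c * mat_inner (calA (outer q)) Y"
      by (simp only: calA_adjoint[OF sym])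
    also have "\<dots> = mat_inner Y (c *\<^sub>R calA (outer q))"
      by (simp add: mat_inner_eq_sum sum_distrib_left mult_ac)
    finally show ?thesis .
  qed
  show ?thesis
    using adj[of "A 0" 1]
    by (simp add: sdp_objective_def tw_objective_def moment_point_def adj mult.commute)
qed

section \<open>Rotations and unit quaternions\<close>

lemma rotation_calA_outer:
  assumes "norm q = 1"
  shows "rotation_matrix (calA (outer q))"
proof -
  define a b c d where "a = q $ 1" "b = q $ 2" "c = q $ 3" "d = q $ 4"
  note abcd = this
  have "(norm q)\<^sup>2 = a\<^sup>2 + b\<^sup>2 + c\<^sup>2 + d\<^sup>2"
    unfolding power2_norm_eq_inner by (simp add: inner_vec_def sum_4 abcd power2_eq_square)
  then have n: "a\<^sup>2 + b\<^sup>2 + c\<^sup>2 + d\<^sup>2 = 1" using assms by simp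
  let ?Q = "calA (outer q)"
  have Q: "?Q = vector [
     vector [a\<^sup>2 - b\<^sup>2 - c\<^sup>2 + d\<^sup>2, 2 * a * b + 2 * c * d, 2 * a * c - 2 * b * d],
     vector [2 * a * b - 2 * c * d, - a\<^sup>2 + b\<^sup>2 - c\<^sup>2 + d\<^sup>2, 2 * b * c + 2 * a * d],
     vector [2 * a * c + 2 * b * d, 2 * b * c - 2 * a * d, - a\<^sup>2 - b\<^sup>2 + c\<^sup>2 + d\<^sup>2]]"
    by (simp add: calA_def outer_def abcd power2_eq_square mult.assoc)
  have "transpose ?Q ** ?Q = (a\<^sup>2 + b\<^sup>2 + c\<^sup>2 + d\<^sup>2)\<^sup>2 *\<^sub>R mat 1"
    unfolding Q
    by (simp add: vec_eq_iff forall_3 matrix_matrix_mult_def transpose_def sum_3 mat_def)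
      (simp add: power2_eq_square algebra_simps)
  then have "orthogonal_matrix ?Q" by (simp add: orthogonal_matrix n)
  moreover have "det ?Q = (a\<^sup>2 + b\<^sup>2 + c\<^sup>2 + d\<^sup>2) ^ 3"
    unfolding Q by (simp add: det_3) (simp add: power2_eq_square power3_eq_cube algebra_simps)
  then have "det ?Q = 1" by (simp add: n)
  ultimately show ?thesis by (simp add: rotation_matrix_def)
qed

text \<open>  The squared distance between \<open>x\<close> and \<open>y \<times> z\<close> is \<open>1 - 2 det(x, y, z) + 1 = 0\<close> by Lagrange's
  identity.\<close>

lemma cross_product_of_orthonormal:
  fixes x1 x2 x3 y1 y2 y3 z1 z2 z3 :: real
  assumes "x1\<^sup>2 + x2\<^sup>2 + x3\<^sup>2 = 1" "y1\<^sup>2 + y2\<^sup>2 + y3\<^sup>2 = 1" "z1\<^sup>2 + z2\<^sup>2 + z3\<^sup>2 = 1"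
    "y1 * z1 + y2 * z2 + y3 * z3 = 0"
    "x1 * (y2 * z3 - y3 * z2) + x2 * (y3 * z1 - y1 * z3) + x3 * (y1 * z2 - y2 * z1) = 1"
  shows "x1 = y2 * z3 - y3 * z2" "x2 = y3 * z1 - y1 * z3" "x3 = y1 * z2 - y2 * z1"
proof -
  have "(x1 - (y2 * z3 - y3 * z2))\<^sup>2 + (x2 - (y3 * z1 - y1 * z3))\<^sup>2 + (x3 - (y1 * z2 - y2 * z1))\<^sup>2 =
    (x1\<^sup>2 + x2\<^sup>2 + x3\<^sup>2)
    - 2 * (x1 * (y2 * z3 - y3 * z2) + x2 * (y3 * z1 - y1 * z3) + x3 * (y1 * z2 - y2 * z1))
    + (y1\<^sup>2 + y2\<^sup>2 + y3\<^sup>2) * (z1\<^sup>2 + z2\<^sup>2 + z3\<^sup>2) - (y1 * z1 + y2 * z2 + y3 * z3)\<^sup>2"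
    by (simp add: power2_eq_square algebra_simps)
  then have *: "(x1 - (y2 * z3 - y3 * z2))\<^sup>2 + (x2 - (y3 * z1 - y1 * z3))\<^sup>2 + (x3 - (y1 * z2 - y2 * z1))\<^sup>2 = 0"
    using assms by simp
  then show "x1 = y2 * z3 - y3 * z2" "x2 = y3 * z1 - y1 * z3" "x3 = y1 * z2 - y2 * z1"
    by (smt (verit) zero_le_power2 power_eq_0_iff)+
qed

text \<open>  If \<open>Q = \<A>(q q\<^sup>T)\<close> for a unit vector \<open>q\<close>, then \<open>I + \<A>\<^sup>*(Q) = 4 q q\<^sup>T\<close>. Conversely
  the \<open>2 \<times> 2\<close> minors of \<open>R = I + \<A>\<^sup>*(Q)\<close> are, for a rotation \<open>Q\<close>, linear combinations of the
  orthonormality relations of rows and columns and of the relations that make \<open>Q\<close> its own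
  cofactor matrix. So \<open>R\<close> has rank one, and \<open>q\<close> can be read off from a row of \<open>R\<close> with
  positive diagonal entry.\<close>

lemma rotation_quaternion:
  assumes "rotation_matrix Q"
  obtains q where "norm q = 1" "Q = calA (outer q)"
proof -
  define a b c d e f g h k where "a = Q $ 1 $ 1" "b = Q $ 1 $ 2" "c = Q $ 1 $ 3"
    "d = Q $ 2 $ 1" "e = Q $ 2 $ 2" "f = Q $ 2 $ 3" "g = Q $ 3 $ 1" "h = Q $ 3 $ 2" "k = Q $ 3 $ 3"
  note entries = this
  from assms have "orthogonal_matrix Q" and det: "det Q = 1" by (auto simp: rotation_matrix_def)
  then have "transpose Q ** Q = mat 1" "Q ** transpose Q = mat 1"
    by (auto simp: orthogonal_matrix_def)
  then have orth: "a\<^sup>2 + d\<^sup>2 + g\<^sup>2 = 1" "b\<^sup>2 + e\<^sup>2 + h\<^sup>2 = 1" "c\<^sup>2 + f\<^sup>2 + k\<^sup>2 = 1"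
    "a * b + d * e + g * h = 0" "a * c + d * f + g * k = 0" "b * c + e * f + h * k = 0"
    "a\<^sup>2 + b\<^sup>2 + c\<^sup>2 = 1" "d\<^sup>2 + e\<^sup>2 + f\<^sup>2 = 1" "g\<^sup>2 + h\<^sup>2 + k\<^sup>2 = 1"
    "a * d + b * e + c * f = 0" "a * g + b * h + c * k = 0" "d * g + e * h + f * k = 0"
    by (simp_all add: vec_eq_iff forall_3 matrix_matrix_mult_def transpose_def sum_3 mat_def
        entries[symmetric] power2_eq_square)
  have det': "a * (e * k - f * h) + b * (f * g - d * k) + c * (d * h - e * g) = 1"
    using det by (simp add: det_3 entries[symmetric] algebra_simps)
  \<comment> \<open>Each row is the cross product of the next two, cyclically.\<close>
  have cof: "a = e * k - f * h" "b = f * g - d * k" "c = d * h - e * g"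
    "d = h * c - k * b" "e = k * a - g * c" "f = g * b - h * a"
    "g = b * f - c * e" "h = c * d - a * f" "k = a * e - b * d"
    using cross_product_of_orthonormal[OF orth(7,8,9,12) det']
      cross_product_of_orthonormal[of d e f g h k a b c] cross_product_of_orthonormal[of g h k a b c d e f]
      orth det' by (simp_all add: algebra_simps)
  define R where "R = mat 1 + calA_adj Q"
  have R: "R $ 1 $ 1 = 1 + a - e - k" "R $ 2 $ 2 = 1 - a + e - k" "R $ 3 $ 3 = 1 - a - e + k"
    "R $ 4 $ 4 = 1 + a + e + k" "R $ 1 $ 2 = b + d" "R $ 2 $ 1 = b + d" "R $ 1 $ 3 = c + g"
    "R $ 3 $ 1 = c + g" "R $ 1 $ 4 = f - h" "R $ 4 $ 1 = f - h" "R $ 2 $ 3 = f + h" "R $ 3 $ 2 = f + h"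
    "R $ 2 $ 4 = g - c" "R $ 4 $ 2 = g - c" "R $ 3 $ 4 = b - d" "R $ 4 $ 3 = b - d"
    by (simp_all add: R_def calA_adj_def vector_4 mat_def entries)
  have minors: "R $ i $ i * R $ j $ l = R $ i $ j * R $ i $ l" for i j l
  proof -
    \<comment> \<open>With all products expanded, each minor is a linear consequence of the
      entrywise relations for \<open>Q\<close>.\<close>
    have m: "(1 + a - e - k) * (1 - a + e - k) = (b + d) * (b + d) \<and>
       (1 + a - e - k) * (1 - a - e + k) = (c + g) * (c + g) \<and>
       (1 + a - e - k) * (1 + a + e + k) = (f - h) * (f - h) \<and>
       (1 - a + e - k) * (1 - a - e + k) = (f + h) * (f + h) \<and>
       (1 - a + e - k) * (1 + a + e + k) = (g - c) * (g - c) \<and>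
       (1 - a - e + k) * (1 + a + e + k) = (b - d) * (b - d) \<and>
       (1 + a - e - k) * (f + h) = (b + d) * (c + g) \<and>
       (1 + a - e - k) * (g - c) = (b + d) * (f - h) \<and>
       (1 + a - e - k) * (b - d) = (c + g) * (f - h) \<and>
       (1 - a + e - k) * (c + g) = (b + d) * (f + h) \<and>
       (1 - a + e - k) * (f - h) = (b + d) * (g - c) \<and>
       (1 - a + e - k) * (b - d) = (f + h) * (g - c) \<and>
       (1 - a - e + k) * (b + d) = (c + g) * (f + h) \<and>
       (1 - a - e + k) * (f - h) = (c + g) * (b - d) \<and>
       (1 - a - e + k) * (g - c) = (f + h) * (b - d) \<and>
       (1 + a + e + k) * (b + d) = (f - h) * (g - c) \<and>
       (1 + a + e + k) * (c + g) = (f - h) * (b - d) \<and>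
       (1 + a + e + k) * (f + h) = (g - c) * (b - d)"
      by (intro conjI; insert orth[unfolded power2_eq_square] cof;
          simp (no_asm_use) only: ring_distribs mult_1 mult_1_right mult_ac; linarith)
    have "\<forall>i j l. R $ i $ i * R $ j $ l = R $ i $ j * R $ i $ l"
      unfolding forall_4 R using m by (simp only: mult.commute simp_thms)
    then show ?thesis by blast
  qed
  have tr: "R $ 1 $ 1 + R $ 2 $ 2 + R $ 3 $ 3 + R $ 4 $ 4 = 4" by (simp add: R)
  then obtain i where i: "R $ i $ i > 0"
    by (smt (verit))
  define q :: "real^4" where "q = (\<chi> j. R $ i $ j / (2 * sqrt (R $ i $ i)))"
  have "outer q $ j $ l = R $ j $ l / 4" for j l
    using i minors[of i j l] by (simp add: outer_def q_def field_simps)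
  then have outer: "outer q = (1 / 4) *\<^sub>R R" by (simp add: vec_eq_iff)
  have "(norm q)\<^sup>2 = trace (outer q)" by (simp add: trace_outer)
  also have "\<dots> = 1" using tr by (simp add: outer trace_def sum_4)
  finally have "norm q = 1" by (simp add: power2_eq_1_iff) (smt (verit) norm_ge_zero)
  moreover have "Q = calA (outer q)"
    by (simp add: vec_eq_iff forall_3 calA_def outer R entries[symmetric])
      (intro conjI; simp add: field_simps)
  ultimately show ?thesis by (rule that)
qed

section \<open>Optimal values and optimal points\<close>

lemma is_arg_max_iff_value:
  assumes "is_max_value f P v"
  shows "is_arg_max f P x \<longleftrightarrow> P x \<and> f x = v"
proof -
  obtain y where "P y" "f y = v" and le: "\<And>x. P x \<Longrightarrow> f x \<le> v"
    using assms by (auto simp: is_max_value_def)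
  then show ?thesis
    unfolding is_arg_max_def by (metis le_less linorder_not_less)
qed

lemma convI:
  assumes "\<And>i. i < m \<Longrightarrow> 0 \<le> u i" "\<And>i. i < m \<Longrightarrow> p i \<in> S" "(\<Sum>i<(m::nat). u i) = 1"
  shows "(\<lambda>n. \<Sum>i<m. u i *\<^sub>R fst (p i) n, \<lambda>n. \<Sum>i<m. u i *\<^sub>R snd (p i) n) \<in> conv S"
  using assms unfolding conv_def by blast

lemma convE:
  assumes "x \<in> conv S"
  obtains m u p where "x = (\<lambda>n. \<Sum>i<m. u i *\<^sub>R fst (p i) n, \<lambda>n. \<Sum>i<m. u i *\<^sub>R snd (p i) n)"
    "\<And>i. i < m \<Longrightarrow> 0 \<le> u i" "\<And>i. i < m \<Longrightarrow> p i \<in> S" "(\<Sum>i<(m::nat). u i) = 1"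
  using assms unfolding conv_def by blast

text \<open>  On the closed interval the maximum exists by compactness; the two ends of the interval give the
  same moment point, so \<open>\<pi>\<close> can be dropped.\<close>

lemma moment_point_objective_attains_max:
  obtains q0 \<omega>0 where "norm q0 = 1" "\<omega>0 \<in> {-pi..<pi}"
    "\<And>q \<omega>. norm q = 1 \<Longrightarrow> \<omega> \<in> {-pi..<pi} \<Longrightarrow>
       sdp_objective N A B (moment_point N q \<omega>) \<le> sdp_objective N A B (moment_point N q0 \<omega>0)"
proof -
  define F where "F = (\<lambda>(q, \<omega>). sdp_objective N A B (moment_point N q \<omega>))"
  have F: "F z = mat_inner (calA_adj (A 0)) (outer (fst z)) +
      (\<Sum>n=1..N. cos (real n * snd z) * mat_inner (calA_adj (A n)) (outer (fst z)) +
        sin (real n * snd z) * mat_inner (calA_adj (B n)) (outer (fst z)))" for z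
    unfolding F_def case_prod_beta sdp_objective_def moment_point_def
    by (simp add: mat_inner_eq_sum sum_distrib_left mult.left_commute)
  have "continuous_on (sphere 0 1 \<times> {-pi..pi}) F"
    unfolding F[abs_def] mat_inner_eq_sum outer_def vec_lambda_beta by (intro continuous_intros)
  moreover have "compact (sphere (0 :: real^4) 1 \<times> {-pi..pi})"
    by (intro compact_Times compact_sphere compact_Icc)
  moreover have "sphere (0 :: real^4) 1 \<times> {-pi..pi} \<noteq> {}"
    by (auto intro!: exI[of _ "axis 1 1"] exI[of _ "0 :: real"])
  ultimately obtain z where z: "z \<in> sphere 0 1 \<times> {-pi..pi}"
    "\<And>y. y \<in> sphere 0 1 \<times> {-pi..pi} \<Longrightarrow> F y \<le> F z"
    using continuous_attains_sup by metis
  define \<omega>0 where "\<omega>0 = (if snd z = pi then - pi else snd z)"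
  have "F (fst z, \<omega>0) = F z" unfolding F by (simp add: \<omega>0_def)
  moreover have "norm (fst z) = 1" "\<omega>0 \<in> {-pi..<pi}"
    using z(1) by (auto simp: \<omega>0_def mem_Times_iff)
  moreover have "F (q, \<omega>) \<le> F z" if "norm q = 1" "\<omega> \<in> {-pi..<pi}" for q \<omega>
    using that by (intro z(2)) auto
  ultimately show ?thesis
    using that[of "fst z" \<omega>0] by (simp add: F_def)
qed

text \<open>  The objective is linear, so its maximum over the convex hull of the moment points is the maximum
  over the moment points themselves, which is the maximum of the Wahba problem; and a convex
  combination attains it exactly when all its points of positive weight do.\<close>

theorem theorem3p2:
  fixes N :: nat and A B :: "nat \<Rightarrow> real^3^3"
  assumes "N \<ge> 1"
  shows "(\<exists>v. is_max_value (tw_objective N A B) tw_feasible v \<and>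
              is_max_value (sdp_objective N A B) (sdp_feasible N) v) \<and>
         {p. is_arg_max (sdp_objective N A B) (sdp_feasible N) p} =
           conv {moment_point N q \<omega> | q \<omega>.
             q \<in> sphere 0 1 \<and> \<omega> \<in> {-pi..<pi} \<and>
             is_arg_max (tw_objective N A B) tw_feasible (\<omega>, calA (outer q))}"
proof -
  let ?f = "sdp_objective N A B" and ?g = "tw_objective N A B"
  let ?S = "{moment_point N q \<omega> | q \<omega>. q \<in> sphere 0 1 \<and> \<omega> \<in> {-pi..<pi}}"
  obtain q0 \<omega>0 where opt: "norm q0 = 1" "\<omega>0 \<in> {-pi..<pi}"
    "\<And>q \<omega>. norm q = 1 \<Longrightarrow> \<omega> \<in> {-pi..<pi} \<Longrightarrow> ?f (moment_point N q \<omega>) \<le> ?f (moment_point N q0 \<omega>0)"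
    by (rule moment_point_objective_attains_max[of N A B]) (rule that)
  define v where "v = ?f (moment_point N q0 \<omega>0)"
  have S_le: "?f p \<le> v" if "p \<in> ?S" for p
    using that opt(3) by (auto simp: v_def)
  have tw: "is_max_value ?g tw_feasible v"
    unfolding is_max_value_def
  proof (intro conjI allI impI)
    show "\<exists>x. tw_feasible x \<and> ?g x = v"
      using opt(1,2) rotation_calA_outer[OF opt(1)]
      by (intro exI[of _ "(\<omega>0, calA (outer q0))"])
        (simp add: tw_feasible_def v_def sdp_objective_moment_point)
  next
    fix x assume x: "tw_feasible x"
    obtain \<omega> Q where \<omega>: "x = (\<omega>, Q)" by (cases x)
    obtain q where "norm q = 1" "Q = calA (outer q)"
      using rotation_quaternion[of Q] x unfolding \<omega> tw_feasible_def by blast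
    then show "?g x \<le> v"
      using S_le[of "moment_point N q \<omega>"] x unfolding \<omega> tw_feasible_def
      by (auto simp: sdp_objective_moment_point)
  qed
  have sdp: "is_max_value ?f (sdp_feasible N) v"
    unfolding is_max_value_def
  proof (intro conjI allI impI)
    show "\<exists>p. sdp_feasible N p \<and> ?f p = v"
      using moment_point_feasible[OF opt(1)] v_def by blast
  next
    fix x assume "sdp_feasible N x"
    from feasible_in_conv_moment_points[OF this] obtain m u p where
      x: "x = (\<lambda>n. \<Sum>i<m. u i *\<^sub>R fst (p i) n, \<lambda>n. \<Sum>i<m. u i *\<^sub>R snd (p i) n)" and
      u: "\<And>i. i < m \<Longrightarrow> 0 \<le> u i" "\<And>i. i < m \<Longrightarrow> p i \<in> ?S" "(\<Sum>i<(m::nat). u i) = 1"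
      by (rule convE) (rule that)
    have "?f x = (\<Sum>i<m. u i * ?f (p i))" unfolding x by (rule sdp_objective_combination)
    also have "\<dots> \<le> (\<Sum>i<m. u i * v)"
      using u(1) S_le[OF u(2)] by (intro sum_mono mult_left_mono) auto
    also have "\<dots> = v" by (simp add: sum_distrib_right[symmetric] u(3))
    finally show "?f x \<le> v" .
  qed
  note arg_max = is_arg_max_iff_value[OF tw] is_arg_max_iff_value[OF sdp]
  let ?O = "{moment_point N q \<omega> | q \<omega>. q \<in> sphere 0 1 \<and> \<omega> \<in> {-pi..<pi} \<and>
    is_arg_max ?g tw_feasible (\<omega>, calA (outer q))}"
  have "is_arg_max ?g tw_feasible (\<omega>, calA (outer q)) \<longleftrightarrow> ?f (moment_point N q \<omega>) = v"
    if "q \<in> sphere 0 1" "\<omega> \<in> {-pi..<pi}" for q \<omega>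
    unfolding arg_max using that rotation_calA_outer[of q]
    by (simp add: sdp_objective_moment_point tw_feasible_def)
  then have O: "?O = {p \<in> ?S. ?f p = v}" by blast
  have "{p. is_arg_max ?f (sdp_feasible N) p} = conv ?O"
  proof (intro equalityI subsetI)
    fix x assume "x \<in> {p. is_arg_max ?f (sdp_feasible N) p}"
    then have x: "sdp_feasible N x" "?f x = v" by (auto simp: arg_max)
    from feasible_in_conv_moment_points[OF x(1)] obtain m u p where
      x_eq: "x = (\<lambda>n. \<Sum>i<m. u i *\<^sub>R fst (p i) n, \<lambda>n. \<Sum>i<m. u i *\<^sub>R snd (p i) n)" and
      u: "\<And>i. i < m \<Longrightarrow> 0 \<le> u i" "\<And>i. i < m \<Longrightarrow> p i \<in> ?S" "(\<Sum>i<(m::nat). u i) = 1"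
      by (rule convE) (rule that)
    have "(\<Sum>i<m. u i * (v - ?f (p i))) = v - ?f x"
      unfolding x_eq sdp_objective_combination
      by (simp add: right_diff_distrib sum_subtractf sum_distrib_right[symmetric] u(3))
    then have "(\<Sum>i<m. u i * (v - ?f (p i))) = 0" using x(2) by simp
    moreover have "0 \<le> u i * (v - ?f (p i))" if "i < m" for i
      using u(1)[OF that] S_le[OF u(2)[OF that]] by simp
    ultimately have tight: "u i = 0 \<or> ?f (p i) = v" if "i < m" for i
      using that sum_nonneg_eq_0_iff[of "{..<m}" "\<lambda>i. u i * (v - ?f (p i))"] by auto
    \<comment> \<open>A point of weight \<open>0\<close> need not be optimal, so it is replaced by
      one that is.\<close>
    define p' where "p' i = (if u i = 0 then moment_point N q0 \<omega>0 else p i)" for i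
    have "x = (\<lambda>n. \<Sum>i<m. u i *\<^sub>R fst (p' i) n, \<lambda>n. \<Sum>i<m. u i *\<^sub>R snd (p' i) n)"
      unfolding x_eq by (auto simp: p'_def intro!: ext sum.cong)
    moreover have "p' i \<in> ?O" if "i < m" for i
      unfolding O using tight[OF that] u(2)[OF that] opt(1,2) by (auto simp: p'_def v_def)
    ultimately show "x \<in> conv ?O"
      using convI[of m u p' ?O] u(1,3) by simp
  next
    fix x assume "x \<in> conv ?O"
    then obtain m u p where
      x: "x = (\<lambda>n. \<Sum>i<m. u i *\<^sub>R fst (p i) n, \<lambda>n. \<Sum>i<m. u i *\<^sub>R snd (p i) n)" and
      u: "\<And>i. i < m \<Longrightarrow> 0 \<le> u i" "\<And>i. i < m \<Longrightarrow> p i \<in> ?O" "(\<Sum>i<(m::nat). u i) = 1"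
      by (rule convE) (rule that)
    have p: "sdp_feasible N (p i)" "?f (p i) = v" if "i < m" for i
      using u(2)[OF that] moment_point_feasible unfolding O by auto
    have "?f x = (\<Sum>i<m. u i * v)"
      unfolding x sdp_objective_combination using p(2) by simp
    also have "\<dots> = v" by (simp add: sum_distrib_right[symmetric] u(3))
    finally show "x \<in> {p. is_arg_max ?f (sdp_feasible N) p}"
      unfolding arg_max x using feasible_combination[of m u N p] u(1,3) p(1) by simp
  qed
  with tw sdp show ?thesis by blast
qed

end
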